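(* Let $\beta\in\ell^1(\mathbb Z)$ be a positive c-self-controlled sequence and let $C_0>0$. There exists $T^*>0$, depending only on $\beta$ and $C_0$ (in particular, independent of $N$), such that if $0<T\le T^*$ then the following holds for any $N\in\mathbb N\cup\{\infty\}$. Let $I_N$ be the index set described in the context, and let $f=(f_{hk})_{h,k\in I_N}$, $g=(g_{hk})_{h,k\in I_N}$ be such that $f_{hk}=f_{kh}\in C^0([0,T])$, $g_{hk}=g_{kh}\in\mathbb R$, and $|f_{hk}(t)|\le C_0\,\beta_h\beta_k$, $|g_{hk}|\le C_0\,\beta_h\beta_k$ for all $h,k\in I_N$, $t\in[0,T]$. Then there exists a unique smooth solution $c=(c_{hk})_{h,k\in I_N}$ on $[0,T]$ to the system $$-\dot c_{hk}+c_{0h}c_{0k}+\sum_{j\in I_N,\ j\ne 0}\big(c_{0,h-j}\,c_{jk}+c_{hj}\,c_{0,k-j}\big)=f_{hk},\qquad c_{hk}(T)=g_{hk},\qquad h,k\in I_N,$$ with $c_{hk}=c_{kh}$, such that, for any $i,j\in I_N$ and $m\in\mathbb N$ (including $m=0$), $$\Big\|\Big(\frac{d}{dt}\Big)^m c_{ij}\Big\|_{\infty;[0,T]}\le K_m\,\beta_i\beta_j ,$$ where the constants $K_m$ depend only on $T^*$, $f$, $g$ and $m$ (in particular, not on $i,j$).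
   Context: A nonnegative sequence $\beta\in\ell^2(\mathbb Z)$ is called c-self-controlled if there is a constant $C>0$ with $\sum_{j\in\mathbb Z}\beta_j\beta_{i-j}\le C\beta_i$ for all $i\in\mathbb Z$. Index set: if $N=\infty$, $I_N=\mathbb Z$ and the sums in the system are series over $\mathbb Z$. If $N\in\mathbb N$, $N\ge1$, $I_N=\{-N',\dots,N''\}$ has exactly $N$ elements, with $N'=N''=(N-1)/2$ if $N$ is odd and $N'=N/2=N''+1$ if $N$ is even; in this case all indices (such as $h-j$ and $k-j$) are understood modulo $N$, with representative in $I_N$.
   Formalization: Since f is only continuous, c need not be smooth (N=1: c'=c²−f); so the m-th derivative of c and its bound K_m β_i β_j are asserted only if f has continuous derivatives of every order l<m, each bounded by a constant times β_h β_k; nothing is added for m=0,1. *)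

theory Defs
  imports "HOL-Analysis.Analysis" "HOL-Library.Extended_Nat"
begin

definition c_self_controlled :: "(int \<Rightarrow> real) \<Rightarrow> bool" where
  "c_self_controlled \<beta> \<longleftrightarrow>
     (\<forall>i. 0 \<le> \<beta> i) \<and> (\<lambda>i. (\<beta> i)\<^sup>2) summable_on UNIV \<and>
     (\<exists>C>0. \<forall>i. (\<Sum>\<^sub>\<infinity>j\<in>UNIV. \<beta> j * \<beta> (i - j)) \<le> C * \<beta> i)"

definition index_set :: "enat \<Rightarrow> int set" where
  "index_set N =
     (case N of
        \<infinity> \<Rightarrow> UNIV
      | enat n \<Rightarrow> (if odd n then {- ((int n - 1) div 2) .. (int n - 1) div 2}
                  else {- (int n div 2) .. int n div 2 - 1}))"

text \<open>For finite \<open>N\<close>, the representative modulo \<open>N\<close> of an index that lies in \<open>index_set N\<close>;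
  see the two lemmas below.\<close>

definition index_rep :: "enat \<Rightarrow> int \<Rightarrow> int" where
  "index_rep N i =
     (case N of
        \<infinity> \<Rightarrow> i
      | enat n \<Rightarrow> (i + int n div 2) mod int n - int n div 2)"

lemma index_rep_mem:
  assumes "1 \<le> N"
  shows "index_rep N i \<in> index_set N"
proof (cases N)
  case (enat n)
  with assms have n: "n > 0" by (simp add: one_enat_def)
  define r where "r = (i + int n div 2) mod int n"
  from n have r: "0 \<le> r" "r < int n"
    by (simp_all add: r_def)
  have "index_rep N i = r - int n div 2"
    by (simp add: enat index_rep_def r_def)
  with r show ?thesis
    using enat by (auto simp: index_set_def elim!: oddE evenE)
qed (simp add: index_rep_def index_set_def)

lemma index_rep_cong:
  "index_rep (enat n) i mod int n = i mod int n"
  by (simp add: index_rep_def mod_diff_left_eq)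

lemma card_index_set: "card (index_set (enat n)) = n"
  by (auto simp: index_set_def elim!: oddE evenE)

text \<open>Iterated derivatives on a set \<open>S\<close>; on \<open>S = {0..T}\<close> they are one-sided at the end points.\<close>

definition nderiv_on :: "real set \<Rightarrow> nat \<Rightarrow> (real \<Rightarrow> real) \<Rightarrow> real \<Rightarrow> real" where
  "nderiv_on S m u = ((\<lambda>v t. vector_derivative v (at t within S)) ^^ m) u"

definition C_on :: "real set \<Rightarrow> nat \<Rightarrow> (real \<Rightarrow> real) \<Rightarrow> bool" where
  "C_on S m u \<longleftrightarrow>
     (\<forall>l<m. nderiv_on S l u differentiable_on S) \<and> continuous_on S (nderiv_on S m u)"

text \<open>Only applied to functions that are continuous on the compact set \<open>S\<close>, for which the
  supremum is finite.\<close>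

definition sup_norm_on :: "real set \<Rightarrow> (real \<Rightarrow> real) \<Rightarrow> real" where
  "sup_norm_on S u = (SUP t\<in>S. \<bar>u t\<bar>)"

text \<open>The \<open>m\<close>-th derivatives of the entries exist, are continuous, and are dominated by the
  matrix \<open>\<beta>\<^sub>h \<beta>\<^sub>k\<close>.\<close>

definition deriv_dominated ::
  "(int \<Rightarrow> real) \<Rightarrow> real \<Rightarrow> enat \<Rightarrow> nat \<Rightarrow> (int \<Rightarrow> int \<Rightarrow> real \<Rightarrow> real) \<Rightarrow> bool" where
  "deriv_dominated \<beta> T N m u \<longleftrightarrow>
     (\<exists>K. \<forall>h\<in>index_set N. \<forall>k\<in>index_set N.
        C_on {0..T} m (u h k) \<and>
        sup_norm_on {0..T} (nderiv_on {0..T} m (u h k)) \<le> K * \<beta> h * \<beta> k)"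

definition admissible_data ::
  "(int \<Rightarrow> real) \<Rightarrow> real \<Rightarrow> real \<Rightarrow> enat \<Rightarrow> (int \<Rightarrow> int \<Rightarrow> real \<Rightarrow> real) \<Rightarrow> (int \<Rightarrow> int \<Rightarrow> real) \<Rightarrow> bool" where
  "admissible_data \<beta> C0 T N f g \<longleftrightarrow>
     (\<forall>h\<in>index_set N. \<forall>k\<in>index_set N.
        (\<forall>t\<in>{0..T}. f h k t = f k h t) \<and> continuous_on {0..T} (f h k) \<and> g h k = g k h \<and>
        (\<forall>t\<in>{0..T}. \<bar>f h k t\<bar> \<le> C0 * \<beta> h * \<beta> k) \<and>
        \<bar>g h k\<bar> \<le> C0 * \<beta> h * \<beta> k)"

definition solves_system ::
  "real \<Rightarrow> enat \<Rightarrow> (int \<Rightarrow> int \<Rightarrow> real \<Rightarrow> real) \<Rightarrow> (int \<Rightarrow> int \<Rightarrow> real) \<Rightarrow> (int \<Rightarrow> int \<Rightarrow> real \<Rightarrow> real) \<Rightarrow> bool" where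
  "solves_system T N f g c \<longleftrightarrow>
     (\<forall>h\<in>index_set N. \<forall>k\<in>index_set N.
        C_on {0..T} 1 (c h k) \<and> c h k T = g h k \<and>
        (\<forall>t\<in>{0..T}.
           (\<lambda>j. c 0 (index_rep N (h - j)) t * c j k t + c h j t * c 0 (index_rep N (k - j)) t)
             summable_on (index_set N - {0}) \<and>
           - nderiv_on {0..T} 1 (c h k) t + c 0 h t * c 0 k t
             + (\<Sum>\<^sub>\<infinity>j\<in>index_set N - {0}.
                  c 0 (index_rep N (h - j)) t * c j k t + c h j t * c 0 (index_rep N (k - j)) t)
           = f h k t))"

text \<open>For \<open>f\<close> merely continuous, a solution is in general no better than continuously
  differentiable: for \<open>N = 1\<close> the system is \<open>c' = c\<^sup>2 - f\<close>. So smoothness of the solution is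
  meant relative to \<open>f\<close>: order \<open>m\<close> is asserted as soon as \<open>f\<close> has dominated derivatives of
  every order below \<open>m\<close>. For admissible data this is no restriction if \<open>m\<close> is \<open>0\<close> or \<open>1\<close>, and
  if \<open>f\<close> has dominated derivatives of all orders then every \<open>m\<close> is covered.\<close>

definition smooth_dominated_solution ::
  "(int \<Rightarrow> real) \<Rightarrow> real \<Rightarrow> enat \<Rightarrow> (int \<Rightarrow> int \<Rightarrow> real \<Rightarrow> real) \<Rightarrow> (int \<Rightarrow> int \<Rightarrow> real) \<Rightarrow>
     (int \<Rightarrow> int \<Rightarrow> real \<Rightarrow> real) \<Rightarrow> bool" where
  "smooth_dominated_solution \<beta> T N f g c \<longleftrightarrow>
     solves_system T N f g c \<and>
     (\<forall>h\<in>index_set N. \<forall>k\<in>index_set N. \<forall>t\<in>{0..T}. c h k t = c k h t) \<and>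
     (\<forall>m. (\<forall>l<m. deriv_dominated \<beta> T N l f) \<longrightarrow> deriv_dominated \<beta> T N m c)"

lemma deriv_dominated_0:
  assumes "admissible_data \<beta> C0 T N f g" "0 < T"
  shows "deriv_dominated \<beta> T N 0 f"
  using assms unfolding deriv_dominated_def
  by (intro exI[of _ C0])
     (auto simp: admissible_data_def C_on_def nderiv_on_def sup_norm_on_def intro!: cSUP_least)

end

theory Submission
  imports Defs
begin

text \<open>
  The system is an ordinary differential equation \<open>c' = Q(c,c) - f\<close> with a quadratic right-hand
  side, solved backwards from \<open>c(T) = g\<close>, in a Banach space: the families \<open>u\<close> with
  \<open>\<bar>u h k\<bar> \<le> M * w h * w k\<close> for a weight \<open>w\<close> on the index set. If the convolution of \<open>w\<close> with
  itself is at most \<open>C * w\<close>, then \<open>Q\<close> is bounded on this space, with constant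
  \<open>(w 0)\<^sup>2 + 2 * C * w 0\<close> (\<open>coupling_dominated\<close>). Picard iteration then gives a solution on a
  time interval whose length depends on this constant and \<open>C0\<close> only (\<open>short_time_existence\<close>), an
  exponentially weighted norm gives uniqueness (\<open>dominated_solution_unique\<close>), and
  differentiating the equation with the product rule for \<open>Q\<close> bounds the higher derivatives
  (\<open>fixpoint_deriv_dominated\<close>).

  For \<open>N = \<infinity>\<close> the weight is \<open>\<beta>\<close>. For finite \<open>N\<close> the convolutions are cyclic, and \<open>\<beta>\<close>
  need not control its own cyclic convolution uniformly in \<open>N\<close>: indices wrap around, and \<open>\<beta>\<close> may
  be much larger at \<open>h + N\<close> than at \<open>h\<close> if it is not symmetric. The remedy is to replace \<open>\<beta>\<close>
  by the weight that sums \<open>\<beta>\<close> over residue classes modulo \<open>N\<close>. Reduction modulo \<open>N\<close> takes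
  convolutions to cyclic convolutions, so the folded weight satisfies the cyclic estimate with the
  constant \<open>C\<close> of \<open>\<beta>\<close> (\<open>folded_convolution\<close>); it lies above \<open>\<beta>\<close>, so the data remain admissible
  with the same \<open>C0\<close>; and its value at \<open>0\<close> is at most the sum of \<open>\<beta>\<close>, which is where
  summability of \<open>\<beta>\<close> enters. Hence the time of existence does not depend on \<open>N\<close>. The bounds in
  terms of the folded weight turn into bounds in terms of \<open>\<beta>\<close> because, for each single \<open>N\<close>, the
  two weights are comparable on the index set (\<open>folded_le_const_mult\<close>).
\<close>

section \<open>Iterated derivatives on an interval\<close>

lemma nderiv_on_Suc:
  "nderiv_on S (Suc m) u = nderiv_on S m (\<lambda>t. vector_derivative u (at t within S))"
  by (simp add: nderiv_on_def funpow_Suc_right del: funpow.simps)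

lemma C_on_0: "C_on S 0 u \<longleftrightarrow> continuous_on S u"
  by (simp add: C_on_def nderiv_on_def)

lemma C_on_Suc:
  "C_on S (Suc m) u \<longleftrightarrow>
     u differentiable_on S \<and> C_on S m (\<lambda>t. vector_derivative u (at t within S))"
  by (auto simp: C_on_def nderiv_on_Suc All_less_Suc2) (simp add: nderiv_on_def)+

lemma vector_derivative_cong_on:
  assumes "\<And>t. t \<in> S \<Longrightarrow> u t = v t" and "t \<in> S"
  shows "vector_derivative u (at t within S) = vector_derivative v (at t within S)"
proof -
  have "(u has_vector_derivative d) (at t within S) \<longleftrightarrow>
        (v has_vector_derivative d) (at t within S)" for d
    using has_vector_derivative_transform[OF assms(2), of u v d]
      has_vector_derivative_transform[OF assms(2), of v u d] assms(1) by auto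
  then show ?thesis
    by (simp add: vector_derivative_def)
qed

lemma nderiv_on_cong:
  assumes "\<And>t. t \<in> S \<Longrightarrow> u t = v t" and "t \<in> S"
  shows "nderiv_on S m u t = nderiv_on S m v t"
  using assms
proof (induction m arbitrary: u v t)
  case 0
  then show ?case by (simp add: nderiv_on_def)
next
  case (Suc m)
  show ?case
    unfolding nderiv_on_Suc
    using Suc.prems by (intro Suc.IH vector_derivative_cong_on) auto
qed

lemma differentiable_on_cong:
  assumes "\<And>t. t \<in> S \<Longrightarrow> u t = v t"
  shows "u differentiable_on S \<longleftrightarrow> v differentiable_on S"
proof -
  have "(u has_derivative D) (at t within S) \<longleftrightarrow> (v has_derivative D) (at t within S)"
    if "t \<in> S" for D t
    using has_derivative_transform[OF that, of u v D] has_derivative_transform[OF that, of v u D] assms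
    by auto
  then show ?thesis
    unfolding differentiable_on_def differentiable_def by simp
qed

lemma C_on_cong:
  assumes "\<And>t. t \<in> S \<Longrightarrow> u t = v t"
  shows "C_on S m u \<longleftrightarrow> C_on S m v"
  using assms
proof (induction m arbitrary: u v)
  case 0
  then show ?case by (auto simp: C_on_0 cong: continuous_on_cong)
next
  case (Suc m)
  show ?case
    unfolding C_on_Suc
    using Suc.prems
    by (intro arg_cong2[of _ _ _ _ "(\<and>)"] differentiable_on_cong Suc.IH vector_derivative_cong_on) auto
qed

lemma deriv_dominated_cong:
  assumes "\<And>h k t. h \<in> index_set N \<Longrightarrow> k \<in> index_set N \<Longrightarrow> t \<in> {0..T} \<Longrightarrow> u h k t = v h k t"
  shows "deriv_dominated \<beta> T N m u \<longleftrightarrow> deriv_dominated \<beta> T N m v"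
proof -
  have "C_on {0..T} m (u h k) = C_on {0..T} m (v h k)"
    "sup_norm_on {0..T} (nderiv_on {0..T} m (u h k)) = sup_norm_on {0..T} (nderiv_on {0..T} m (v h k))"
    if "h \<in> index_set N" "k \<in> index_set N" for h k
    using assms[OF that]
    by (auto simp: sup_norm_on_def intro!: C_on_cong SUP_cong arg_cong[of _ _ abs] nderiv_on_cong)
  then show ?thesis
    unfolding deriv_dominated_def by simp
qed

text \<open>Inductions on the order of differentiation peel off the innermost derivative. The condition
  of order \<open>Suc m\<close> bounds the top derivative only, so what remains of \<open>u\<close> itself is its
  differentiability.\<close>

lemma deriv_dominated_Suc:
  "deriv_dominated \<beta> T N (Suc m) u \<longleftrightarrow>
     (\<forall>h\<in>index_set N. \<forall>k\<in>index_set N. u h k differentiable_on {0..T}) \<and>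
     deriv_dominated \<beta> T N m (\<lambda>h k t. vector_derivative (u h k) (at t within {0..T}))"
  unfolding deriv_dominated_def C_on_Suc nderiv_on_Suc by blast

lemma vector_derivative_on_interval:
  fixes u :: "real \<Rightarrow> real"
  assumes "0 < T" "t \<in> {0..T}" "(u has_vector_derivative d) (at t within {0..T})"
  shows "vector_derivative u (at t within {0..T}) = d"
  using assms by (rule vector_derivative_within_closed_interval)

lemma deriv_dominated_SucI:
  assumes "0 < T"
    and "\<And>h k t. h \<in> index_set N \<Longrightarrow> k \<in> index_set N \<Longrightarrow> t \<in> {0..T} \<Longrightarrow>
           (u h k has_vector_derivative v h k t) (at t within {0..T})"
    and "deriv_dominated \<beta> T N m v"
  shows "deriv_dominated \<beta> T N (Suc m) u"
  unfolding deriv_dominated_Suc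
proof (intro conjI ballI)
  show "u h k differentiable_on {0..T}" if "h \<in> index_set N" "k \<in> index_set N" for h k
    unfolding differentiable_on_def
    by (intro ballI differentiableI_vector[OF assms(2)[OF that]])
  have "vector_derivative (u h k) (at t within {0..T}) = v h k t"
    if "h \<in> index_set N" "k \<in> index_set N" "t \<in> {0..T}" for h k t
    using assms(1,2) that by (intro vector_derivative_on_interval)
  then show "deriv_dominated \<beta> T N m (\<lambda>h k t. vector_derivative (u h k) (at t within {0..T}))"
    using assms(3) by (subst deriv_dominated_cong) auto
qed

lemma deriv_dominated_SucE:
  assumes "deriv_dominated \<beta> T N (Suc m) u"
  obtains v where "deriv_dominated \<beta> T N m v"
    and "\<And>h k t. h \<in> index_set N \<Longrightarrow> k \<in> index_set N \<Longrightarrow> t \<in> {0..T} \<Longrightarrow>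
           (u h k has_vector_derivative v h k t) (at t within {0..T})"
proof (rule that)
  show "deriv_dominated \<beta> T N m (\<lambda>h k t. vector_derivative (u h k) (at t within {0..T}))"
    using assms by (simp add: deriv_dominated_Suc)
  show "(u h k has_vector_derivative vector_derivative (u h k) (at t within {0..T})) (at t within {0..T})"
    if "h \<in> index_set N" "k \<in> index_set N" "t \<in> {0..T}" for h k t
    using assms that unfolding deriv_dominated_Suc differentiable_on_def
    by (simp flip: vector_derivative_works)
qed

lemma deriv_dominated_0_iff:
  assumes "0 \<le> T"
  shows "deriv_dominated \<beta> T N 0 u \<longleftrightarrow>
    (\<exists>K. \<forall>h\<in>index_set N. \<forall>k\<in>index_set N.
       continuous_on {0..T} (u h k) \<and> (\<forall>t\<in>{0..T}. \<bar>u h k t\<bar> \<le> K * \<beta> h * \<beta> k))"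
proof -
  have "sup_norm_on {0..T} v \<le> K \<longleftrightarrow> (\<forall>t\<in>{0..T}. \<bar>v t\<bar> \<le> K)"
    if "continuous_on {0..T} v" for v :: "real \<Rightarrow> real" and K
  proof -
    have "compact ((\<lambda>t. \<bar>v t\<bar>) ` {0..T})"
      using that by (intro compact_continuous_image continuous_intros) auto
    then have "bdd_above ((\<lambda>t. \<bar>v t\<bar>) ` {0..T})"
      by (intro bounded_imp_bdd_above compact_imp_bounded)
    then show ?thesis
      unfolding sup_norm_on_def using assms by (subst cSUP_le_iff) auto
  qed
  then have "(continuous_on {0..T} v \<and> sup_norm_on {0..T} v \<le> K) =
      (continuous_on {0..T} v \<and> (\<forall>t\<in>{0..T}. \<bar>v t\<bar> \<le> K))" for v K
    by blast
  then show ?thesis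
    unfolding deriv_dominated_def C_on_0 by (simp add: nderiv_on_def)
qed

text \<open>Domination is a qualitative condition: it only sees the weight up to a constant factor.
  This is how it is carried from \<open>\<beta>\<close> to a comparable weight and back.\<close>

lemma deriv_dominated_weaken:
  assumes "\<And>h. h \<in> index_set N \<Longrightarrow> 0 \<le> \<beta> h \<and> \<beta> h \<le> \<kappa> * w h"
    and "deriv_dominated \<beta> T N m u"
  shows "deriv_dominated w T N m u"
proof -
  obtain K where K: "\<And>h k. h \<in> index_set N \<Longrightarrow> k \<in> index_set N \<Longrightarrow> C_on {0..T} m (u h k) \<and>
        sup_norm_on {0..T} (nderiv_on {0..T} m (u h k)) \<le> K * \<beta> h * \<beta> k"
    using assms(2) unfolding deriv_dominated_def by blast
  have "K * \<beta> h * \<beta> k \<le> (\<bar>K\<bar> * \<kappa>\<^sup>2) * w h * w k" if "h \<in> index_set N" "k \<in> index_set N" for h k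
  proof -
    have "K * (\<beta> h * \<beta> k) \<le> \<bar>K\<bar> * ((\<kappa> * w h) * (\<kappa> * w k))"
      using assms(1)[OF that(1)] assms(1)[OF that(2)]
      by (intro mult_mono) auto
    then show ?thesis
      by (simp add: power2_eq_square mult_ac)
  qed
  with K have "C_on {0..T} m (u h k) \<and>
      sup_norm_on {0..T} (nderiv_on {0..T} m (u h k)) \<le> (\<bar>K\<bar> * \<kappa>\<^sup>2) * w h * w k"
    if "h \<in> index_set N" "k \<in> index_set N" for h k
    using that order_trans by blast
  then show ?thesis
    unfolding deriv_dominated_def by blast
qed

lemma deriv_dominated_add_scaled:
  assumes "0 < T" "\<And>h. h \<in> index_set N \<Longrightarrow> 0 \<le> \<beta> h"
    and "deriv_dominated \<beta> T N m u" "deriv_dominated \<beta> T N m v"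
  shows "deriv_dominated \<beta> T N m (\<lambda>h k t. u h k t + a * v h k t)"
  using assms(3,4)
proof (induction m arbitrary: u v)
  case 0
  note iff = deriv_dominated_0_iff[OF less_imp_le[OF assms(1)]]
  obtain K where
    K: "\<And>h k. h \<in> index_set N \<Longrightarrow> k \<in> index_set N \<Longrightarrow>
      continuous_on {0..T} (u h k) \<and> (\<forall>t\<in>{0..T}. \<bar>u h k t\<bar> \<le> K * \<beta> h * \<beta> k)"
    using 0(1) unfolding iff by blast
  obtain L where
    L: "\<And>h k. h \<in> index_set N \<Longrightarrow> k \<in> index_set N \<Longrightarrow>
      continuous_on {0..T} (v h k) \<and> (\<forall>t\<in>{0..T}. \<bar>v h k t\<bar> \<le> L * \<beta> h * \<beta> k)"
    using 0(2) unfolding iff by blast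
  have "\<bar>u h k t + a * v h k t\<bar> \<le> (K + \<bar>a\<bar> * L) * \<beta> h * \<beta> k"
    if "h \<in> index_set N" "k \<in> index_set N" "t \<in> {0..T}" for h k t
  proof -
    have "\<bar>u h k t + a * v h k t\<bar> \<le> \<bar>u h k t\<bar> + \<bar>a\<bar> * \<bar>v h k t\<bar>"
      using abs_triangle_ineq[of "u h k t" "a * v h k t"] by (simp add: abs_mult)
    also have "\<dots> \<le> K * \<beta> h * \<beta> k + \<bar>a\<bar> * (L * \<beta> h * \<beta> k)"
      using K[OF that(1,2)] L[OF that(1,2)] that(3) by (intro add_mono mult_left_mono) auto
    finally show ?thesis by (simp add: algebra_simps)
  qed
  moreover have "continuous_on {0..T} (\<lambda>t. u h k t + a * v h k t)"
    if "h \<in> index_set N" "k \<in> index_set N" for h k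
    using K[OF that] L[OF that] by (intro continuous_intros) auto
  ultimately show ?case
    unfolding iff by blast
next
  case (Suc m)
  obtain u' where u': "deriv_dominated \<beta> T N m u'"
      "\<And>h k t. h \<in> index_set N \<Longrightarrow> k \<in> index_set N \<Longrightarrow> t \<in> {0..T} \<Longrightarrow>
           (u h k has_vector_derivative u' h k t) (at t within {0..T})"
    using deriv_dominated_SucE[OF Suc.prems(1)] by blast
  obtain v' where v': "deriv_dominated \<beta> T N m v'"
      "\<And>h k t. h \<in> index_set N \<Longrightarrow> k \<in> index_set N \<Longrightarrow> t \<in> {0..T} \<Longrightarrow>
           (v h k has_vector_derivative v' h k t) (at t within {0..T})"
    using deriv_dominated_SucE[OF Suc.prems(2)] by blast
  show ?case
  proof (rule deriv_dominated_SucI[OF assms(1) _ Suc.IH[OF u'(1) v'(1)]])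
    fix h k t assume "h \<in> index_set N" "k \<in> index_set N" "t \<in> {0..T}"
    then show "((\<lambda>t. u h k t + a * v h k t) has_vector_derivative u' h k t + a * v' h k t)
        (at t within {0..T})"
      by (intro has_vector_derivative_add has_vector_derivative_mult_right u'(2) v'(2))
  qed
qed

section \<open>Series of functions with a summable majorant\<close>

text \<open>Tannery's theorem, or dominated convergence for series: the majorant makes the partial sums
  converge uniformly on \<open>S\<close>, and a uniform limit may be interchanged with the limit at \<open>x\<close>.\<close>

lemma tendsto_infsum_majorant:
  fixes f :: "'i \<Rightarrow> real \<Rightarrow> real"
  assumes "\<And>j. j \<in> J \<Longrightarrow> (f j \<longlongrightarrow> l j) (at x within S)"
    and "\<And>j y. j \<in> J \<Longrightarrow> y \<in> S \<Longrightarrow> \<bar>f j y\<bar> \<le> M j"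
    and "\<And>j. j \<in> J \<Longrightarrow> \<bar>l j\<bar> \<le> M j"
    and "M summable_on J"
  shows "((\<lambda>y. \<Sum>\<^sub>\<infinity>j\<in>J. f j y) \<longlongrightarrow> (\<Sum>\<^sub>\<infinity>j\<in>J. l j)) (at x within S)"
proof -
  have partial: "\<forall>\<^sub>F F in finite_subsets_at_top J.
      ((\<lambda>y. \<Sum>j\<in>F. f j y) \<longlongrightarrow> (\<Sum>j\<in>F. l j)) (at x within S)"
    by (rule eventually_finite_subsets_at_top_weakI, rule tendsto_sum, rule assms(1)) (rule subsetD)
  have "l summable_on J"
    by (rule abs_summable_summable,
        rule Infinite_Sum.abs_summable_on_comparison_test'[OF assms(4)])
       (simp add: assms(3))
  then have limit: "((\<lambda>F. \<Sum>j\<in>F. l j) \<longlongrightarrow> (\<Sum>\<^sub>\<infinity>j\<in>J. l j)) (finite_subsets_at_top J)"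
    by (rule infsum_tendsto)
  have "uniform_limit S (\<lambda>F y. \<Sum>j\<in>F. f j y) (\<lambda>y. \<Sum>\<^sub>\<infinity>j\<in>J. f j y) (finite_subsets_at_top J)"
    by (rule Weierstrass_m_test_general[OF _ assms(4)]) (simp add: assms(2))
  from swap_uniform_limit[OF partial limit this finite_subsets_at_top_neq_bot]
  show ?thesis .
qed

lemma continuous_on_infsum_majorant:
  fixes f :: "'i \<Rightarrow> real \<Rightarrow> real"
  assumes "\<And>j. j \<in> J \<Longrightarrow> continuous_on S (f j)"
    and "\<And>j y. j \<in> J \<Longrightarrow> y \<in> S \<Longrightarrow> \<bar>f j y\<bar> \<le> M j"
    and "M summable_on J"
  shows "continuous_on S (\<lambda>y. \<Sum>\<^sub>\<infinity>j\<in>J. f j y)"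
  unfolding continuous_on_def
proof
  fix x assume "x \<in> S"
  show "((\<lambda>y. \<Sum>\<^sub>\<infinity>j\<in>J. f j y) \<longlongrightarrow> (\<Sum>\<^sub>\<infinity>j\<in>J. f j x)) (at x within S)"
  proof (rule tendsto_infsum_majorant[OF _ _ _ assms(3)])
    show "(f j \<longlongrightarrow> f j x) (at x within S)" if "j \<in> J" for j
      using assms(1)[OF that] \<open>x \<in> S\<close> by (simp add: continuous_on_def)
  qed (use assms(2) \<open>x \<in> S\<close> in blast)+
qed

text \<open>By the mean value inequality the bound \<open>M j\<close> of the derivative of \<open>f j\<close> also bounds its
  difference quotients, so these can be summed by dominated convergence.\<close>

lemma has_vector_derivative_infsum_majorant:
  fixes f f' :: "'i \<Rightarrow> real \<Rightarrow> real"
  assumes deriv: "\<And>j t. j \<in> J \<Longrightarrow> t \<in> S \<Longrightarrow> (f j has_vector_derivative f' j t) (at t within S)"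
    and bound: "\<And>j t. j \<in> J \<Longrightarrow> t \<in> S \<Longrightarrow> \<bar>f' j t\<bar> \<le> M j"
    and M: "M summable_on J"
    and f: "\<And>t. t \<in> S \<Longrightarrow> (\<lambda>j. f j t) summable_on J"
    and S: "convex S" "x \<in> S"
  shows "((\<lambda>t. \<Sum>\<^sub>\<infinity>j\<in>J. f j t) has_vector_derivative (\<Sum>\<^sub>\<infinity>j\<in>J. f' j x)) (at x within S)"
proof -
  have punctured: "at x within S = at x within (S - {x})"
    by (simp add: at_within_def)
  have "((\<lambda>y. \<Sum>\<^sub>\<infinity>j\<in>J. (f j y - f j x) / (y - x)) \<longlongrightarrow> (\<Sum>\<^sub>\<infinity>j\<in>J. f' j x)) (at x within S)"
    unfolding punctured
  proof (rule tendsto_infsum_majorant[where M = M])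
    fix j assume j: "j \<in> J"
    show "((\<lambda>y. (f j y - f j x) / (y - x)) \<longlongrightarrow> f' j x) (at x within (S - {x}))"
      using deriv[OF j S(2)] unfolding punctured[symmetric]
      by (simp add: has_real_derivative_iff_has_vector_derivative[symmetric] has_field_derivative_iff)
    show "\<bar>(f j y - f j x) / (y - x)\<bar> \<le> M j" if "y \<in> S - {x}" for y
    proof -
      have "norm (f j y - f j x) \<le> M j * norm (y - x)"
        using deriv[OF j] bound[OF j] S that
        by (intro field_differentiable_bound[where S = S and f' = "f' j"])
           (simp_all add: has_real_derivative_iff_has_vector_derivative)
      then show ?thesis
        using that by (simp add: divide_le_eq)
    qed
    show "\<bar>f' j x\<bar> \<le> M j"
      using bound[OF j S(2)] .
  qed (rule M)
  moreover have "(\<Sum>\<^sub>\<infinity>j\<in>J. (f j y - f j x) / (y - x)) =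
      ((\<Sum>\<^sub>\<infinity>j\<in>J. f j y) - (\<Sum>\<^sub>\<infinity>j\<in>J. f j x)) / (y - x)" if "y \<in> S" for y
    using f[OF that] f[OF S(2)]
    using infsum_add[OF f[OF that] summable_on_uminus[THEN iffD2, OF f[OF S(2)]]]
    by (simp add: divide_inverse infsum_cmult_left' infsum_uminus)
  ultimately have "((\<lambda>y. ((\<Sum>\<^sub>\<infinity>j\<in>J. f j y) - (\<Sum>\<^sub>\<infinity>j\<in>J. f j x)) / (y - x)) \<longlongrightarrow> (\<Sum>\<^sub>\<infinity>j\<in>J. f' j x))
      (at x within S)"
    by (simp cong: Lim_cong_within)
  then show ?thesis
    by (simp add: has_real_derivative_iff_has_vector_derivative[symmetric] has_field_derivative_iff)
qed

section \<open>The quadratic coupling\<close>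

text \<open>The nonlinearity of the system is \<open>coupling N c c\<close>. Splitting it into a bilinear form, with
  one factor of row \<open>0\<close> in each product taken from \<open>u\<close> and the other factor from \<open>v\<close>, makes differences
  and derivatives of the nonlinearity accessible to a single estimate.\<close>

definition coupling ::
  "enat \<Rightarrow> (int \<Rightarrow> int \<Rightarrow> real \<Rightarrow> real) \<Rightarrow> (int \<Rightarrow> int \<Rightarrow> real \<Rightarrow> real) \<Rightarrow> int \<Rightarrow> int \<Rightarrow> real \<Rightarrow> real" where
  "coupling N u v h k t =
     u 0 h t * v 0 k t +
     (\<Sum>\<^sub>\<infinity>j\<in>index_set N - {0}.
        u 0 (index_rep N (h - j)) t * v j k t + v h j t * u 0 (index_rep N (k - j)) t)"

text \<open>A weight on the index set that is self-controlled for the convolution that occurs in the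
  system, which is cyclic for finite \<open>N\<close>. The length of the time interval
  will depend on the weight only through \<open>C\<close> and \<open>w 0\<close>.\<close>

locale convolution_weight =
  fixes N :: enat and w :: "int \<Rightarrow> real" and C :: real
  assumes N_ge_1: "1 \<le> N"
    and C_nonneg: "0 \<le> C"
    and w_pos: "h \<in> index_set N \<Longrightarrow> 0 < w h"
    and conv_summable: "h \<in> index_set N \<Longrightarrow>
          (\<lambda>j. w (index_rep N (h - j)) * w j) summable_on index_set N"
    and conv_le: "h \<in> index_set N \<Longrightarrow>
          (\<Sum>\<^sub>\<infinity>j\<in>index_set N. w (index_rep N (h - j)) * w j) \<le> C * w h"
begin

abbreviation I :: "int set" where "I \<equiv> index_set N"

lemma zero_mem [simp]: "0 \<in> I"
  using N_ge_1 by (cases N) (auto simp: index_set_def one_enat_def elim!: oddE evenE)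

lemma rep_mem [simp]: "index_rep N i \<in> I"
  using N_ge_1 by (rule index_rep_mem)

lemma w_nonneg: "h \<in> I \<Longrightarrow> 0 \<le> w h"
  using w_pos by (simp add: less_imp_le)

text \<open>For families bounded by \<open>w h * w k\<close>, the term with index \<open>j\<close> of the series in \<open>coupling\<close> is
  at most this. Up to factors independent of \<open>j\<close>, its two summands are terms of the convolution
  of \<open>w\<close> with itself, which self-control sums to a multiple of \<open>w 0 * w h * w k\<close>.\<close>

definition majorant :: "int \<Rightarrow> int \<Rightarrow> int \<Rightarrow> real" where
  "majorant h k j =
     w 0 * (w k * (w (index_rep N (h - j)) * w j) + w h * (w (index_rep N (k - j)) * w j))"

lemma majorant_nonneg: "h \<in> I \<Longrightarrow> k \<in> I \<Longrightarrow> j \<in> I \<Longrightarrow> 0 \<le> majorant h k j"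
  by (simp add: majorant_def w_nonneg)

lemma majorant_summable:
  assumes "h \<in> I" "k \<in> I"
  shows "majorant h k summable_on (I - {0})"
proof -
  have "majorant h k summable_on I"
    unfolding majorant_def
    by (intro summable_on_cmult_right summable_on_add conv_summable assms)
  then show ?thesis
    by (rule summable_on_subset_banach) auto
qed

lemma infsum_majorant_le:
  assumes "h \<in> I" "k \<in> I"
  shows "(\<Sum>\<^sub>\<infinity>j\<in>I - {0}. majorant h k j) \<le> 2 * C * w 0 * w h * w k"
proof -
  have full: "majorant h k summable_on I"
    unfolding majorant_def
    by (intro summable_on_cmult_right summable_on_add conv_summable assms)
  have "(\<Sum>\<^sub>\<infinity>j\<in>I - {0}. majorant h k j) \<le> (\<Sum>\<^sub>\<infinity>j\<in>I. majorant h k j)"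
    using assms by (intro infsum_mono2 full majorant_summable majorant_nonneg) auto
  also have "\<dots> = w 0 * (w k * (\<Sum>\<^sub>\<infinity>j\<in>I. w (index_rep N (h - j)) * w j) +
      w h * (\<Sum>\<^sub>\<infinity>j\<in>I. w (index_rep N (k - j)) * w j))"
    unfolding majorant_def infsum_cmult_right'
    by (subst infsum_add) (auto simp: infsum_cmult_right' intro!: summable_on_cmult_right conv_summable assms)
  also have "\<dots> \<le> w 0 * (w k * (C * w h) + w h * (C * w k))"
    using assms by (intro mult_left_mono add_mono conv_le w_nonneg) auto
  finally show ?thesis by (simp add: algebra_simps)
qed

text \<open>The bound is a function of time, not a number: existence is obtained from a constant one
  and uniqueness from an exponential one.\<close>

definition dominated :: "real set \<Rightarrow> (real \<Rightarrow> real) \<Rightarrow> (int \<Rightarrow> int \<Rightarrow> real \<Rightarrow> real) \<Rightarrow> bool" where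
  "dominated S \<phi> u \<longleftrightarrow> (\<forall>h\<in>I. \<forall>k\<in>I. \<forall>t\<in>S. \<bar>u h k t\<bar> \<le> \<phi> t * w h * w k)"

lemma dominatedD:
  "dominated S \<phi> u \<Longrightarrow> h \<in> I \<Longrightarrow> k \<in> I \<Longrightarrow> t \<in> S \<Longrightarrow> \<bar>u h k t\<bar> \<le> \<phi> t * w h * w k"
  by (simp add: dominated_def)

lemma dominated_nonneg:
  assumes "dominated S \<phi> u" "t \<in> S"
  shows "0 \<le> \<phi> t"
proof -
  have "0 \<le> \<phi> t * w 0 * w 0"
    using dominatedD[OF assms(1) zero_mem zero_mem assms(2)] by linarith
  then show ?thesis
    using w_pos[OF zero_mem] by (simp add: zero_le_mult_iff)
qed

lemma coupling_term_le:
  assumes u: "dominated S \<phi> u" and v: "dominated S \<psi> v"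
    and "h \<in> I" "k \<in> I" "j \<in> I" "t \<in> S"
  shows "\<bar>u 0 (index_rep N (h - j)) t * v j k t + v h j t * u 0 (index_rep N (k - j)) t\<bar>
    \<le> \<phi> t * \<psi> t * majorant h k j"
proof -
  have "\<bar>u 0 (index_rep N (h - j)) t\<bar> * \<bar>v j k t\<bar>
      \<le> (\<phi> t * w 0 * w (index_rep N (h - j))) * (\<psi> t * w j * w k)"
    using assms dominated_nonneg[OF u] w_nonneg by (intro mult_mono dominatedD[OF u] dominatedD[OF v]) auto
  moreover have "\<bar>v h j t\<bar> * \<bar>u 0 (index_rep N (k - j)) t\<bar>
      \<le> (\<psi> t * w h * w j) * (\<phi> t * w 0 * w (index_rep N (k - j)))"
    using assms dominated_nonneg[OF v] w_nonneg by (intro mult_mono dominatedD[OF u] dominatedD[OF v]) auto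
  moreover have "\<bar>u 0 (index_rep N (h - j)) t * v j k t + v h j t * u 0 (index_rep N (k - j)) t\<bar>
      \<le> \<bar>u 0 (index_rep N (h - j)) t\<bar> * \<bar>v j k t\<bar> + \<bar>v h j t\<bar> * \<bar>u 0 (index_rep N (k - j)) t\<bar>"
    unfolding abs_mult[symmetric] by (rule abs_triangle_ineq)
  ultimately show ?thesis
    by (simp add: majorant_def algebra_simps)
qed

lemma coupling_summable:
  assumes u: "dominated S \<phi> u" and v: "dominated S \<psi> v" and "h \<in> I" "k \<in> I" "t \<in> S"
  shows "(\<lambda>j. u 0 (index_rep N (h - j)) t * v j k t + v h j t * u 0 (index_rep N (k - j)) t)
    summable_on (I - {0})"
proof (rule abs_summable_summable, rule Infinite_Sum.abs_summable_on_comparison_test')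
  show "(\<lambda>j. \<phi> t * \<psi> t * majorant h k j) summable_on (I - {0})"
    by (intro summable_on_cmult_right majorant_summable assms)
qed (use coupling_term_le[OF u v] assms in auto)

definition coupling_bound :: real where
  "coupling_bound = (w 0)\<^sup>2 + 2 * C * w 0"

lemma coupling_bound_nonneg: "0 \<le> coupling_bound"
  using C_nonneg w_nonneg[OF zero_mem] by (simp add: coupling_bound_def)

text \<open>This estimate carries the whole theorem: the coupling maps the weighted space of
  families to itself, boundedly, with a constant that depends only on \<open>C\<close> and \<open>w 0\<close>.\<close>

lemma coupling_dominated:
  assumes u: "dominated S \<phi> u" and v: "dominated S \<psi> v"
  shows "dominated S (\<lambda>t. coupling_bound * \<phi> t * \<psi> t) (coupling N u v)"
  unfolding dominated_def
proof (intro ballI)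
  fix h k t assume hk: "h \<in> I" "k \<in> I" and t: "t \<in> S"
  note nn = dominated_nonneg[OF u t] dominated_nonneg[OF v t]
  let ?f = "\<lambda>j. u 0 (index_rep N (h - j)) t * v j k t + v h j t * u 0 (index_rep N (k - j)) t"
  have "\<bar>\<Sum>\<^sub>\<infinity>j\<in>I - {0}. ?f j\<bar> \<le> (\<Sum>\<^sub>\<infinity>j\<in>I - {0}. \<phi> t * \<psi> t * majorant h k j)"
    using norm_infsum_le[OF has_sum_infsum has_sum_infsum, of ?f "I - {0}" "\<lambda>j. \<phi> t * \<psi> t * majorant h k j"]
      coupling_summable[OF u v hk t] coupling_term_le[OF u v hk _ t]
      summable_on_cmult_right[OF majorant_summable[OF hk]]
    by (simp del: infsum_cmult_right')
  also have "\<dots> \<le> \<phi> t * \<psi> t * (2 * C * w 0 * w h * w k)"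
    using nn infsum_majorant_le[OF hk] by (simp add: infsum_cmult_right' mult_left_mono)
  finally have sum: "\<bar>\<Sum>\<^sub>\<infinity>j\<in>I - {0}. ?f j\<bar> \<le> \<phi> t * \<psi> t * (2 * C * w 0 * w h * w k)" .
  have "\<bar>u 0 h t\<bar> * \<bar>v 0 k t\<bar> \<le> (\<phi> t * w 0 * w h) * (\<psi> t * w 0 * w k)"
    using nn hk t w_nonneg by (intro mult_mono dominatedD[OF u] dominatedD[OF v]) auto
  then have "\<bar>u 0 h t * v 0 k t\<bar> \<le> \<phi> t * \<psi> t * ((w 0)\<^sup>2 * w h * w k)"
    by (simp add: abs_mult power2_eq_square mult_ac)
  with sum have "\<bar>coupling N u v h k t\<bar> \<le>
      \<phi> t * \<psi> t * ((w 0)\<^sup>2 * w h * w k) + \<phi> t * \<psi> t * (2 * C * w 0 * w h * w k)"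
    unfolding coupling_def using abs_triangle_ineq add_mono order_trans by blast
  then show "\<bar>coupling N u v h k t\<bar> \<le> coupling_bound * \<phi> t * \<psi> t * w h * w k"
    by (simp add: coupling_bound_def algebra_simps)
qed

lemma coupling_continuous:
  assumes u: "dominated S (\<lambda>_. M) u" "\<And>h k. h \<in> I \<Longrightarrow> k \<in> I \<Longrightarrow> continuous_on S (u h k)"
    and v: "dominated S (\<lambda>_. L) v" "\<And>h k. h \<in> I \<Longrightarrow> k \<in> I \<Longrightarrow> continuous_on S (v h k)"
    and hk: "h \<in> I" "k \<in> I"
  shows "continuous_on S (coupling N u v h k)"
  unfolding coupling_def
proof (intro continuous_on_add continuous_on_mult)
  show "continuous_on S (\<lambda>t. \<Sum>\<^sub>\<infinity>j\<in>I - {0}.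
      u 0 (index_rep N (h - j)) t * v j k t + v h j t * u 0 (index_rep N (k - j)) t)"
  proof (rule continuous_on_infsum_majorant)
    show "(\<lambda>j. M * L * majorant h k j) summable_on (I - {0})"
      by (intro summable_on_cmult_right majorant_summable hk)
  qed (use coupling_term_le[OF u(1) v(1) hk] u(2) v(2) hk in \<open>auto intro!: continuous_on_add continuous_on_mult\<close>)
qed (use u(2) v(2) hk in auto)

text \<open>Polarisation, \<open>Q(u,u) - Q(v,v) = Q(u-v,u) + Q(v,u-v)\<close>. The bounds make all three series
  converge, so that the series for \<open>Q(u,u)\<close> may be split.\<close>

lemma coupling_diff:
  assumes u: "dominated S \<phi> u" and v: "dominated S \<psi> v"
    and d: "dominated S \<delta> (\<lambda>h k t. u h k t - v h k t)"
    and hk: "h \<in> I" "k \<in> I" and t: "t \<in> S"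
  shows "coupling N u u h k t - coupling N v v h k t =
    coupling N (\<lambda>h k t. u h k t - v h k t) u h k t + coupling N v (\<lambda>h k t. u h k t - v h k t) h k t"
proof -
  note s1 = coupling_summable[OF d u hk t] and s2 = coupling_summable[OF v d hk t]
    and s3 = coupling_summable[OF v v hk t]
  have "(\<Sum>\<^sub>\<infinity>j\<in>I - {0}. u 0 (index_rep N (h - j)) t * u j k t + u h j t * u 0 (index_rep N (k - j)) t) =
    (\<Sum>\<^sub>\<infinity>j\<in>I - {0}. (u 0 (index_rep N (h - j)) t - v 0 (index_rep N (h - j)) t) * u j k t
       + u h j t * (u 0 (index_rep N (k - j)) t - v 0 (index_rep N (k - j)) t)) +
    (\<Sum>\<^sub>\<infinity>j\<in>I - {0}. v 0 (index_rep N (h - j)) t * (u j k t - v j k t)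
       + (u h j t - v h j t) * v 0 (index_rep N (k - j)) t) +
    (\<Sum>\<^sub>\<infinity>j\<in>I - {0}. v 0 (index_rep N (h - j)) t * v j k t + v h j t * v 0 (index_rep N (k - j)) t)"
    unfolding infsum_add[OF s1 s2, symmetric] infsum_add[OF summable_on_add[OF s1 s2] s3, symmetric]
    by (rule infsum_cong) (simp add: algebra_simps)
  then show ?thesis
    by (simp add: coupling_def algebra_simps)
qed

lemma coupling_lipschitz:
  assumes u: "dominated S (\<lambda>_. M) u" and v: "dominated S (\<lambda>_. M) v"
    and d: "dominated S \<phi> (\<lambda>h k t. u h k t - v h k t)"
  shows "dominated S (\<lambda>t. 2 * coupling_bound * M * \<phi> t)
    (\<lambda>h k t. coupling N u u h k t - coupling N v v h k t)"
  unfolding dominated_def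
proof (intro ballI)
  fix h k t assume hk: "h \<in> I" "k \<in> I" and t: "t \<in> S"
  show "\<bar>coupling N u u h k t - coupling N v v h k t\<bar> \<le> 2 * coupling_bound * M * \<phi> t * w h * w k"
    using dominatedD[OF coupling_dominated[OF d u] hk t] dominatedD[OF coupling_dominated[OF v d] hk t]
    unfolding coupling_diff[OF u v d hk t] by (simp add: algebra_simps)
qed

lemma deriv_dominated_0_iff_dominated:
  assumes "0 < T"
  shows "deriv_dominated w T N 0 u \<longleftrightarrow>
    (\<forall>h\<in>I. \<forall>k\<in>I. continuous_on {0..T} (u h k)) \<and> (\<exists>M. dominated {0..T} (\<lambda>_. M) u)"
  unfolding deriv_dominated_0_iff[OF less_imp_le[OF assms]] dominated_def by blast

text \<open>The product rule. Domination of the first derivatives provides the summable majorant that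
  justifies differentiating the series term by term.\<close>

lemma coupling_deriv:
  assumes u: "dominated S (\<lambda>_. M) u" and v: "dominated S (\<lambda>_. L) v"
    and u': "dominated S (\<lambda>_. M') u'" and v': "dominated S (\<lambda>_. L') v'"
    and du: "\<And>h k t. h \<in> I \<Longrightarrow> k \<in> I \<Longrightarrow> t \<in> S \<Longrightarrow> (u h k has_vector_derivative u' h k t) (at t within S)"
    and dv: "\<And>h k t. h \<in> I \<Longrightarrow> k \<in> I \<Longrightarrow> t \<in> S \<Longrightarrow> (v h k has_vector_derivative v' h k t) (at t within S)"
    and S: "convex S" and hk: "h \<in> I" "k \<in> I" and t: "t \<in> S"
  shows "(coupling N u v h k has_vector_derivative
    coupling N u' v h k t + coupling N u v' h k t) (at t within S)"
proof -
  have product: "((\<lambda>t. a t * b t) has_vector_derivative a' * b s + a s * b') (at s within S)"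
    if "(a has_vector_derivative a') (at s within S)" "(b has_vector_derivative b') (at s within S)"
    for a b :: "real \<Rightarrow> real" and a' b' s
    using has_vector_derivative_mult[OF that] by (simp add: add.commute)
  let ?f = "\<lambda>j s. u 0 (index_rep N (h - j)) s * v j k s + v h j s * u 0 (index_rep N (k - j)) s"
  let ?g = "\<lambda>j s. u' 0 (index_rep N (h - j)) s * v j k s + v h j s * u' 0 (index_rep N (k - j)) s"
  let ?g' = "\<lambda>j s. u 0 (index_rep N (h - j)) s * v' j k s + v' h j s * u 0 (index_rep N (k - j)) s"
  have "((\<lambda>s. \<Sum>\<^sub>\<infinity>j\<in>I - {0}. ?f j s) has_vector_derivative (\<Sum>\<^sub>\<infinity>j\<in>I - {0}. ?g j t + ?g' j t)) (at t within S)"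
  proof (rule has_vector_derivative_infsum_majorant)
    fix j s assume j: "j \<in> I - {0}" and s: "s \<in> S"
    have "((?f j) has_vector_derivative
       (u' 0 (index_rep N (h - j)) s * v j k s + u 0 (index_rep N (h - j)) s * v' j k s) +
       (v' h j s * u 0 (index_rep N (k - j)) s + v h j s * u' 0 (index_rep N (k - j)) s)) (at s within S)"
      using j s hk by (intro has_vector_derivative_add product du dv) auto
    then show "((?f j) has_vector_derivative (?g j s + ?g' j s)) (at s within S)"
      by (simp add: algebra_simps)
    show "\<bar>?g j s + ?g' j s\<bar> \<le> (M' * L + M * L') * majorant h k j"
      using coupling_term_le[OF u' v hk _ s, of j] coupling_term_le[OF u v' hk _ s, of j] j
      by (simp add: algebra_simps)
  qed (use coupling_summable[OF u v hk] majorant_summable[OF hk] S t in \<open>auto intro: summable_on_cmult_right\<close>)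
  then have "(coupling N u v h k has_vector_derivative
      (u' 0 h t * v 0 k t + u 0 h t * v' 0 k t) + (\<Sum>\<^sub>\<infinity>j\<in>I - {0}. ?g j t + ?g' j t)) (at t within S)"
    unfolding coupling_def using hk t by (intro has_vector_derivative_add product du dv) auto
  then show ?thesis
    unfolding coupling_def
    using infsum_add[OF coupling_summable[OF u' v hk t] coupling_summable[OF u v' hk t]]
    by (simp add: algebra_simps)
qed

text \<open>Iterating the product rule: the derivative of \<open>Q(u,v)\<close> is \<open>Q(u',v) + Q(u,v')\<close>, two couplings
  of families with one order of domination less. Quantifying over both families in the
  induction avoids the binomial formula for derivatives of higher order.\<close>

lemma coupling_deriv_dominated:
  assumes "0 < T" "\<forall>l\<le>m. deriv_dominated w T N l u" "\<forall>l\<le>m. deriv_dominated w T N l v"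
  shows "deriv_dominated w T N m (coupling N u v)"
  using assms(2,3)
proof (induction m arbitrary: u v)
  case 0
  then obtain M L where
    "dominated {0..T} (\<lambda>_. M) u" "\<And>h k. h \<in> I \<Longrightarrow> k \<in> I \<Longrightarrow> continuous_on {0..T} (u h k)"
    "dominated {0..T} (\<lambda>_. L) v" "\<And>h k. h \<in> I \<Longrightarrow> k \<in> I \<Longrightarrow> continuous_on {0..T} (v h k)"
    using deriv_dominated_0_iff_dominated[OF assms(1)] by auto
  then show ?case
    unfolding deriv_dominated_0_iff_dominated[OF assms(1)]
    using coupling_continuous[of "{0..T}" M u L v] coupling_dominated[of "{0..T}" "\<lambda>_. M" u "\<lambda>_. L" v]
    by auto
next
  case (Suc m)
  let ?D = "\<lambda>u h k t. vector_derivative (u h k) (at t within {0..T})"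
  have step: "(\<exists>M. dominated {0..T} (\<lambda>_. M) u) \<and> (\<exists>M. dominated {0..T} (\<lambda>_. M) (?D u)) \<and>
      (\<forall>l\<le>m. deriv_dominated w T N l u) \<and> (\<forall>l\<le>m. deriv_dominated w T N l (?D u)) \<and>
      (\<forall>h\<in>I. \<forall>k\<in>I. \<forall>t\<in>{0..T}. (u h k has_vector_derivative ?D u h k t) (at t within {0..T}))"
    if u: "\<forall>l\<le>Suc m. deriv_dominated w T N l u" for u
  proof -
    have "\<forall>l\<le>m. deriv_dominated w T N l (?D u)"
      using u deriv_dominated_Suc[of w T N _ u] by (meson Suc_le_mono)
    moreover have "deriv_dominated w T N 0 u" "deriv_dominated w T N (Suc 0) u"
      using u by auto
    ultimately show ?thesis
      using u deriv_dominated_0_iff_dominated[OF assms(1)] unfolding deriv_dominated_Suc differentiable_on_def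
      by (simp flip: vector_derivative_works)
  qed
  from step[OF Suc.prems(1)] step[OF Suc.prems(2)]
  obtain M M' L L' where *: "dominated {0..T} (\<lambda>_. M) u" "dominated {0..T} (\<lambda>_. L) v"
      "dominated {0..T} (\<lambda>_. M') (?D u)" "dominated {0..T} (\<lambda>_. L') (?D v)"
    by blast
  have "deriv_dominated w T N m (coupling N (?D u) v)" "deriv_dominated w T N m (coupling N u (?D v))"
    using step[OF Suc.prems(1)] step[OF Suc.prems(2)] by (auto intro!: Suc.IH)
  then have "deriv_dominated w T N m (\<lambda>h k t. coupling N (?D u) v h k t + 1 * coupling N u (?D v) h k t)"
    by (intro deriv_dominated_add_scaled assms(1) w_nonneg)
  then show ?case
    using step[OF Suc.prems(1)] step[OF Suc.prems(2)]
    by (intro deriv_dominated_SucI[OF assms(1) coupling_deriv[OF *]]) auto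
qed

end

section \<open>The backward Cauchy problem for a given weight\<close>

lemma geometric_steps_limit:
  fixes x :: "nat \<Rightarrow> real"
  assumes "\<And>n. \<bar>x (Suc n) - x n\<bar> \<le> A / 2 ^ n"
  shows "\<bar>x n - lim x\<bar> \<le> 2 * A / 2 ^ n" and "x \<longlonglongrightarrow> lim x"
proof -
  have "0 \<le> A" using assms[of 0] by simp
  have dist: "\<bar>x (n + m) - x n\<bar> \<le> 2 * A / 2 ^ n - 2 * A / 2 ^ (n + m)" for n m
  proof (induction m)
    case (Suc m)
    have "2 * A / 2 ^ (n + m) - A / 2 ^ (n + m) = 2 * A / 2 ^ (n + Suc m)"
      by (simp add: field_simps)
    then show ?case
      using Suc assms[of "n + m"] by simp
  qed simp
  have le: "\<bar>x (n + m) - x n\<bar> \<le> 2 * A / 2 ^ n" for n m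
  proof -
    have "0 \<le> 2 * A / 2 ^ (n + m)" using \<open>0 \<le> A\<close> by simp
    then show ?thesis using dist[of n m] by linarith
  qed
  have lim0: "(\<lambda>n. 2 * A / 2 ^ n) \<longlonglongrightarrow> 0"
    by (rule LIMSEQ_divide_realpow_zero) simp
  have "Cauchy x"
  proof (rule CauchyI')
    fix e :: real assume "0 < e"
    with lim0 obtain n0 where n0: "\<And>n. n \<ge> n0 \<Longrightarrow> 2 * A / 2 ^ n < e"
      using order_tendstoD(2)[OF lim0, of e] unfolding eventually_sequentially by blast
    have "dist (x m) (x n) < e" if "n0 \<le> m" "m < n" for m n
    proof -
      have "\<bar>x (m + (n - m)) - x m\<bar> < e"
        using le[of m "n - m"] n0[OF that(1)] by (rule le_less_trans)
      then show ?thesis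
        using that by (simp add: dist_real_def abs_minus_commute)
    qed
    then show "\<exists>M. \<forall>m\<ge>M. \<forall>n>m. dist (x m) (x n) < e" by blast
  qed
  then show conv: "x \<longlonglongrightarrow> lim x"
    by (intro convergent_LIMSEQ_iff[THEN iffD1] Cauchy_convergent)
  have "(\<lambda>m. \<bar>x (n + m) - x n\<bar>) \<longlonglongrightarrow> \<bar>lim x - x n\<bar>"
    by (intro tendsto_rabs tendsto_diff tendsto_const
        LIMSEQ_ignore_initial_segment[OF conv, of n, unfolded add.commute[of _ n]])
  then have "\<bar>lim x - x n\<bar> \<le> 2 * A / 2 ^ n"
    by (rule LIMSEQ_le_const2) (intro exI allI impI le)
  then show "\<bar>x n - lim x\<bar> \<le> 2 * A / 2 ^ n"
    by (simp add: abs_minus_commute)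
qed

locale backward_problem = convolution_weight +
  fixes T C0 :: real and f :: "int \<Rightarrow> int \<Rightarrow> real \<Rightarrow> real" and g :: "int \<Rightarrow> int \<Rightarrow> real"
  assumes T_pos: "0 < T"
    and data: "admissible_data w C0 T N f g"
begin

definition rhs :: "(int \<Rightarrow> int \<Rightarrow> real \<Rightarrow> real) \<Rightarrow> int \<Rightarrow> int \<Rightarrow> real \<Rightarrow> real" where
  "rhs u h k t = coupling N u u h k t - f h k t"

text \<open>The integral form of the system, integrated backwards from the datum at time \<open>T\<close>.\<close>

definition picard :: "(int \<Rightarrow> int \<Rightarrow> real \<Rightarrow> real) \<Rightarrow> int \<Rightarrow> int \<Rightarrow> real \<Rightarrow> real" where
  "picard u h k t = g h k - integral {t..T} (rhs u h k)"

definition bounded_family :: "real \<Rightarrow> (int \<Rightarrow> int \<Rightarrow> real \<Rightarrow> real) \<Rightarrow> bool" where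
  "bounded_family M u \<longleftrightarrow>
     dominated {0..T} (\<lambda>_. M) u \<and> (\<forall>h\<in>I. \<forall>k\<in>I. continuous_on {0..T} (u h k))"

lemma f_dominated: "dominated {0..T} (\<lambda>_. C0) f"
  and g_dominated: "dominated S (\<lambda>_. C0) (\<lambda>h k t. g h k)"
  and f_continuous: "h \<in> I \<Longrightarrow> k \<in> I \<Longrightarrow> continuous_on {0..T} (f h k)"
  and f_sym: "h \<in> I \<Longrightarrow> k \<in> I \<Longrightarrow> t \<in> {0..T} \<Longrightarrow> f h k t = f k h t"
  and g_sym: "h \<in> I \<Longrightarrow> k \<in> I \<Longrightarrow> g h k = g k h"
  using data unfolding admissible_data_def dominated_def by blast+

lemma bounded_familyD:
  assumes "bounded_family M u"
  shows "dominated {0..T} (\<lambda>_. M) u"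
    and "h \<in> I \<Longrightarrow> k \<in> I \<Longrightarrow> continuous_on {0..T} (u h k)"
    and "h \<in> I \<Longrightarrow> k \<in> I \<Longrightarrow> t \<in> {0..T} \<Longrightarrow> \<bar>u h k t\<bar> \<le> M * w h * w k"
  using assms dominatedD[of "{0..T}" "\<lambda>_. M" u h k t] by (simp_all add: bounded_family_def)

lemma rhs_continuous:
  assumes "bounded_family M u" "h \<in> I" "k \<in> I"
  shows "continuous_on {0..T} (rhs u h k)"
  unfolding rhs_def using assms
  by (intro continuous_on_diff coupling_continuous[of "{0..T}" M u M u] f_continuous)
     (auto simp: bounded_family_def)

lemma rhs_dominated:
  assumes "bounded_family M u" "h \<in> I" "k \<in> I" "t \<in> {0..T}"
  shows "\<bar>rhs u h k t\<bar> \<le> (coupling_bound * M\<^sup>2 + C0) * w h * w k"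
proof -
  have u: "dominated {0..T} (\<lambda>_. M) u"
    using assms(1) by (simp add: bounded_family_def)
  show ?thesis
    using dominatedD[OF coupling_dominated[OF u u] assms(2-)] dominatedD[OF f_dominated assms(2-)]
    by (simp add: rhs_def power2_eq_square algebra_simps)
qed

lemma picard_deriv:
  assumes "bounded_family M u" "h \<in> I" "k \<in> I" "t \<in> {0..T}"
  shows "(picard u h k has_vector_derivative rhs u h k t) (at t within {0..T})"
proof -
  note cont = rhs_continuous[OF assms(1-3)]
  have "((\<lambda>t. g h k - integral {0..T} (rhs u h k) + integral {0..t} (rhs u h k))
      has_vector_derivative 0 + rhs u h k t) (at t within {0..T})"
    by (intro has_vector_derivative_add has_vector_derivative_const
        integral_has_vector_derivative cont assms(4))
  then have deriv: "((\<lambda>t. g h k - integral {0..T} (rhs u h k) + integral {0..t} (rhs u h k))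
      has_vector_derivative rhs u h k t) (at t within {0..T})"
    by simp
  have "picard u h k t = g h k - integral {0..T} (rhs u h k) + integral {0..t} (rhs u h k)"
    if "t \<in> {0..T}" for t
    using Henstock_Kurzweil_Integration.integral_combine[of 0 t T "rhs u h k"]
      integrable_continuous_real[OF cont] that
    by (simp add: picard_def)
  from has_vector_derivative_transform[OF assms(4) this deriv] show ?thesis .
qed

lemma picard_bounded_family:
  assumes u: "bounded_family M u" and M: "C0 + T * (coupling_bound * M\<^sup>2 + C0) \<le> R"
  shows "bounded_family R (picard u)"
  unfolding bounded_family_def dominated_def
proof (intro conjI ballI)
  fix h k assume hk: "h \<in> I" "k \<in> I"
  show "continuous_on {0..T} (picard u h k)"
    using picard_deriv[OF u hk] by (rule continuous_on_vector_derivative)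
  fix t assume t: "t \<in> {0..T}"
  define K where "K = coupling_bound * M\<^sup>2 + C0"
  have "0 \<le> C0" using dominated_nonneg[OF f_dominated t] .
  then have K: "0 \<le> K" using coupling_bound_nonneg by (simp add: K_def)
  have "norm (integral {t..T} (rhs u h k)) \<le> (K * w h * w k) * (T - t)"
    using t rhs_dominated[OF u hk]
    by (intro integral_bound continuous_on_subset[OF rhs_continuous[OF u hk]]) (auto simp: K_def)
  also have "\<dots> \<le> (K * w h * w k) * T"
    using t K hk w_nonneg by (intro mult_left_mono) auto
  finally have "\<bar>picard u h k t\<bar> \<le> C0 * w h * w k + (K * w h * w k) * T"
    using dominatedD[OF g_dominated hk t] by (simp add: picard_def)
  also have "\<dots> = (C0 + T * K) * (w h * w k)" by (simp add: algebra_simps)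
  also have "\<dots> \<le> R * (w h * w k)"
    using M hk w_nonneg by (intro mult_right_mono) (auto simp: K_def)
  finally show "\<bar>picard u h k t\<bar> \<le> R * w h * w k" by simp
qed

text \<open>Polarisation bounds \<open>Q(u,u) - Q(v,v)\<close> by \<open>2 * coupling_bound * M\<close> times the bound of \<open>u - v\<close>,
  and the integral is taken of that.\<close>

lemma picard_lipschitz:
  assumes u: "bounded_family M u" and v: "bounded_family M v"
    and d: "dominated {0..T} \<phi> (\<lambda>h k t. u h k t - v h k t)"
    and \<phi>: "continuous_on {0..T} \<phi>"
  shows "dominated {0..T} (\<lambda>t. 2 * coupling_bound * M * integral {t..T} \<phi>)
    (\<lambda>h k t. picard u h k t - picard v h k t)"
  unfolding dominated_def
proof (intro ballI)
  fix h k t assume hk: "h \<in> I" "k \<in> I" and t: "t \<in> {0..T}"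
  have int: "rhs u h k integrable_on {t..T}" "rhs v h k integrable_on {t..T}" "\<phi> integrable_on {t..T}"
    using t
    by (auto intro!: integrable_continuous_real
        intro: continuous_on_subset[OF rhs_continuous[OF u hk]]
          continuous_on_subset[OF rhs_continuous[OF v hk]] continuous_on_subset[OF \<phi>])
  have "norm (integral {t..T} (\<lambda>s. rhs u h k s - rhs v h k s)) \<le>
      integral {t..T} (\<lambda>s. 2 * coupling_bound * M * w h * w k * \<phi> s)"
  proof (rule integral_norm_bound_integral)
    show "norm (rhs u h k s - rhs v h k s) \<le> 2 * coupling_bound * M * w h * w k * \<phi> s"
      if "s \<in> {t..T}" for s
    proof -
      have "s \<in> {0..T}" using that t by auto
      from dominatedD[OF coupling_lipschitz[OF _ _ d] hk this] u v
      show ?thesis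
        by (simp add: bounded_family_def rhs_def mult_ac)
    qed
  qed (intro integrable_diff integrable_on_mult_right int)+
  moreover have "picard u h k t - picard v h k t = - integral {t..T} (\<lambda>s. rhs u h k s - rhs v h k s)"
    by (simp add: picard_def Henstock_Kurzweil_Integration.integral_diff int)
  ultimately show "\<bar>picard u h k t - picard v h k t\<bar> \<le>
      2 * coupling_bound * M * integral {t..T} \<phi> * w h * w k"
    by (simp add: mult_ac)
qed

lemma coupling_sym:
  assumes "\<And>h k t. h \<in> I \<Longrightarrow> k \<in> I \<Longrightarrow> t \<in> {0..T} \<Longrightarrow> u h k t = u k h t"
    and "h \<in> I" "k \<in> I" "t \<in> {0..T}"
  shows "coupling N u u h k t = coupling N u u k h t"
proof -
  have eq: "u 0 (index_rep N (h - j)) t * u j k t + u h j t * u 0 (index_rep N (k - j)) t =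
      u 0 (index_rep N (k - j)) t * u j h t + u k j t * u 0 (index_rep N (h - j)) t" if "j \<in> I" for j
    using assms(1)[OF assms(2) that assms(4)] assms(1)[OF assms(3) that assms(4)] by (simp add: mult_ac)
  show ?thesis
    unfolding coupling_def by (intro arg_cong2[of _ _ _ _ "(+)"] infsum_cong eq) simp_all
qed

text \<open>The transpose of a solution satisfies, a priori, a different system, with \<open>c h 0\<close> in place
  of \<open>c 0 h\<close>. So the symmetry of the solution cannot be read off from the equation; it is
  inherited from the Picard iterates.\<close>

lemma picard_sym:
  assumes "\<And>h k t. h \<in> I \<Longrightarrow> k \<in> I \<Longrightarrow> t \<in> {0..T} \<Longrightarrow> u h k t = u k h t"
    and "h \<in> I" "k \<in> I" "t \<in> {0..T}"
  shows "picard u h k t = picard u k h t"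
proof -
  have "rhs u h k s = rhs u k h s" if "s \<in> {t..T}" for s
    using that assms(4) coupling_sym[OF assms(1) assms(2,3)] f_sym[OF assms(2,3)] by (simp add: rhs_def)
  then show ?thesis
    using g_sym[OF assms(2,3)]
      Henstock_Kurzweil_Integration.integral_cong[of "{t..T}" "rhs u h k" "rhs u k h"]
    by (simp add: picard_def)
qed

lemma picard_fixpoint_solves_system:
  assumes c: "bounded_family M c"
    and fixpoint: "\<And>h k t. h \<in> I \<Longrightarrow> k \<in> I \<Longrightarrow> t \<in> {0..T} \<Longrightarrow> c h k t = picard c h k t"
  shows "solves_system T N f g c"
    and "\<And>h k t. h \<in> I \<Longrightarrow> k \<in> I \<Longrightarrow> t \<in> {0..T} \<Longrightarrow>
           (c h k has_vector_derivative rhs c h k t) (at t within {0..T})"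
proof -
  show deriv: "(c h k has_vector_derivative rhs c h k t) (at t within {0..T})"
    if "h \<in> I" "k \<in> I" "t \<in> {0..T}" for h k t
    using has_vector_derivative_transform[OF that(3) fixpoint[OF that(1,2)] picard_deriv[OF c that]] .
  have nderiv: "nderiv_on {0..T} 1 (c h k) t = rhs c h k t" if "h \<in> I" "k \<in> I" "t \<in> {0..T}" for h k t
    using vector_derivative_on_interval[OF T_pos that(3) deriv[OF that]] by (simp add: nderiv_on_def)
  have "C_on {0..T} 1 (c h k)" if hk: "h \<in> I" "k \<in> I" for h k
    unfolding C_on_def
  proof
    show "\<forall>l<1. nderiv_on {0..T} l (c h k) differentiable_on {0..T}"
      using differentiableI_vector[OF deriv[OF hk]] by (simp add: nderiv_on_def differentiable_on_def)
    show "continuous_on {0..T} (nderiv_on {0..T} 1 (c h k))"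
      by (rule continuous_on_cong[OF refl nderiv[OF hk], THEN iffD2]) (simp_all add: rhs_continuous[OF c hk])
  qed
  moreover have "c h k T = g h k" if "h \<in> I" "k \<in> I" for h k
    using fixpoint[OF that, of T] T_pos by (simp add: picard_def)
  moreover have dom: "dominated {0..T} (\<lambda>_. M) c"
    using c by (simp add: bounded_family_def)
  ultimately show "solves_system T N f g c"
    unfolding solves_system_def
    using nderiv by (intro ballI conjI coupling_summable[OF dom dom]) (simp_all add: rhs_def coupling_def)
qed

lemma solution_is_picard_fixpoint:
  assumes c: "solves_system T N f g c" "bounded_family M c"
    and hkt: "h \<in> I" "k \<in> I" "t \<in> {0..T}"
  shows "c h k t = picard c h k t"
proof -
  have "(c h k has_vector_derivative rhs c h k s) (at s within {t..T})" if "s \<in> {t..T}" for s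
  proof -
    have s: "s \<in> {0..T}" using that hkt by auto
    have "c h k differentiable_on {0..T}"
      using c(1) hkt C_on_Suc[of "{0..T}" 0 "c h k"] by (simp add: solves_system_def)
    then have "(c h k has_vector_derivative vector_derivative (c h k) (at s within {0..T})) (at s within {0..T})"
      using s by (simp add: differentiable_on_def flip: vector_derivative_works)
    moreover have "- nderiv_on {0..T} 1 (c h k) s + c 0 h s * c 0 k s +
        (\<Sum>\<^sub>\<infinity>j\<in>I - {0}. c 0 (index_rep N (h - j)) s * c j k s + c h j s * c 0 (index_rep N (k - j)) s)
        = f h k s"
      using c(1) hkt s unfolding solves_system_def by blast
    then have "nderiv_on {0..T} 1 (c h k) s = rhs c h k s"
      by (simp add: rhs_def coupling_def)
    ultimately have "(c h k has_vector_derivative rhs c h k s) (at s within {0..T})"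
      by (simp add: nderiv_on_def)
    then show ?thesis
      by (rule has_vector_derivative_within_subset) (use hkt in auto)
  qed
  then have "(rhs c h k has_integral c h k T - c h k t) {t..T}"
    using hkt by (intro fundamental_theorem_of_calculus) auto
  moreover have "c h k T = g h k"
    using c(1) hkt by (simp add: solves_system_def)
  ultimately show ?thesis
    by (simp add: picard_def integral_unique)
qed

text \<open>Bootstrapping with \<open>c' = Q(c,c) - f\<close>: if \<open>c\<close> is dominated up to order \<open>m\<close> then so is
  \<open>Q(c,c)\<close>, and together with the order \<open>m\<close> of \<open>f\<close> this gives the order \<open>m + 1\<close> of \<open>c\<close>.\<close>

lemma fixpoint_deriv_dominated:
  assumes c: "bounded_family M c"
    and deriv: "\<And>h k t. h \<in> I \<Longrightarrow> k \<in> I \<Longrightarrow> t \<in> {0..T} \<Longrightarrow>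
           (c h k has_vector_derivative rhs c h k t) (at t within {0..T})"
    and f: "\<forall>l<m. deriv_dominated w T N l f"
  shows "\<forall>l\<le>m. deriv_dominated w T N l c"
  using f
proof (induction m)
  case 0
  then show ?case
    using c deriv_dominated_0_iff_dominated[OF T_pos] by (auto simp: bounded_family_def)
next
  case (Suc m)
  then have IH: "\<forall>l\<le>m. deriv_dominated w T N l c" by simp
  have "deriv_dominated w T N m (\<lambda>h k t. coupling N c c h k t + (-1) * f h k t)"
    using Suc.prems by (intro deriv_dominated_add_scaled T_pos w_nonneg coupling_deriv_dominated IH) auto
  then have "deriv_dominated w T N (Suc m) c"
    by (intro deriv_dominated_SucI[OF T_pos deriv]) (auto simp: rhs_def)
  with IH show ?case by (simp add: le_Suc_eq)
qed

text \<open>The Picard map preserves the ball of radius \<open>2 * C0\<close>, which leaves room \<open>C0\<close> for the integral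
  next to the datum, and contracts distances there by the factor
  \<open>4 * coupling_bound * C0 * T\<close>. The condition on \<open>T\<close> makes this factor at most one half.\<close>

lemma short_time_existence:
  assumes T: "T * (8 * coupling_bound * C0 + 1) \<le> 1"
  shows "\<exists>c. smooth_dominated_solution w T N f g c"
proof -
  define x where "x n = (picard ^^ n) (\<lambda>h k t. g h k)" for n
  have x_Suc: "x (Suc n) = picard (x n)" for n by (simp add: x_def)
  have T0: "0 \<in> {0..T}" using T_pos by simp
  have C0: "0 \<le> C0" using dominated_nonneg[OF f_dominated T0] .
  have TB: "4 * coupling_bound * C0 * T \<le> 1 / 2"
    using T T_pos by (simp add: algebra_simps)
  have "C0 * (T * (8 * coupling_bound * C0 + 1)) \<le> C0 * 1"
    using T C0 by (rule mult_left_mono)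
  moreover have "C0 * (T * (4 * coupling_bound * C0 + 1)) \<le> C0 * (T * (8 * coupling_bound * C0 + 1))"
    using C0 T_pos coupling_bound_nonneg by (intro mult_left_mono) auto
  ultimately have ball: "C0 + T * (coupling_bound * (2 * C0)\<^sup>2 + C0) \<le> 2 * C0"
    by (simp add: power2_eq_square algebra_simps)
  have contract: "dominated {0..T} (\<lambda>_. A / 2) (\<lambda>h k t. picard u h k t - picard v h k t)"
    if u: "bounded_family (2 * C0) u" and v: "bounded_family (2 * C0) v"
      and d: "dominated {0..T} (\<lambda>_. A) (\<lambda>h k t. u h k t - v h k t)" for u v A
    unfolding dominated_def
  proof (intro ballI)
    fix h k t assume hk: "h \<in> I" "k \<in> I" and t: "t \<in> {0..T}"
    have A: "0 \<le> A" using dominated_nonneg[OF d T0] .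
    have "4 * coupling_bound * C0 * (T - t) \<le> 4 * coupling_bound * C0 * T"
      using t C0 coupling_bound_nonneg by (intro mult_left_mono) auto
    with TB have "4 * coupling_bound * C0 * (T - t) \<le> 1 / 2" by linarith
    then have "4 * coupling_bound * C0 * (T - t) * (A * w h * w k) \<le> 1 / 2 * (A * w h * w k)"
      using A hk w_nonneg by (intro mult_right_mono) auto
    moreover have "\<bar>picard u h k t - picard v h k t\<bar> \<le>
        2 * coupling_bound * (2 * C0) * integral {t..T} (\<lambda>_. A) * w h * w k"
      using dominatedD[OF picard_lipschitz[OF u v d] hk t] by simp
    moreover have "\<dots> = 4 * coupling_bound * C0 * (T - t) * (A * w h * w k)"
      using t by simp
    ultimately show "\<bar>picard u h k t - picard v h k t\<bar> \<le> A / 2 * w h * w k"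
      by linarith
  qed
  have x_bounded: "bounded_family (2 * C0) (x n)" for n
  proof (induction n)
    case 0
    have "\<bar>g h k\<bar> \<le> 2 * C0 * w h * w k" if "h \<in> I" "k \<in> I" for h k
    proof -
      have "0 \<le> C0 * w h * w k" using C0 that w_nonneg by simp
      then show ?thesis using dominatedD[OF g_dominated that UNIV_I] by simp
    qed
    then show ?case by (simp add: x_def bounded_family_def dominated_def)
  next
    case (Suc n)
    then show ?case unfolding x_Suc using ball by (rule picard_bounded_family)
  qed
  have x_sym: "x n h k t = x n k h t" if "h \<in> I" "k \<in> I" "t \<in> {0..T}" for n h k t
    using that
  proof (induction n arbitrary: h k t)
    case 0
    then show ?case by (simp add: x_def g_sym)
  next
    case (Suc n)
    then show ?case unfolding x_Suc by (intro picard_sym)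
  qed
  have x_step: "dominated {0..T} (\<lambda>_. 4 * C0 / 2 ^ n) (\<lambda>h k t. x (Suc n) h k t - x n h k t)" for n
  proof (induction n)
    case 0
    show ?case
      unfolding dominated_def
    proof (intro ballI)
      fix h k t assume hkt: "h \<in> I" "k \<in> I" "t \<in> {0..T}"
      have "\<bar>x n h k t\<bar> \<le> 2 * C0 * w h * w k" for n
        by (rule bounded_familyD(3)[OF x_bounded hkt])
      from this[of 0] this[of "Suc 0"]
      show "\<bar>x (Suc 0) h k t - x 0 h k t\<bar> \<le> 4 * C0 / 2 ^ 0 * w h * w k" by simp
    qed
  next
    case (Suc n)
    from contract[OF x_bounded x_bounded this]
    show ?case by (simp add: x_Suc mult_ac)
  qed
  define c where "c h k t = lim (\<lambda>n. x n h k t)" for h k t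
  have lim: "(\<lambda>n. x n h k t) \<longlonglongrightarrow> c h k t"
    and err: "\<bar>x n h k t - c h k t\<bar> \<le> 8 * C0 / 2 ^ n * w h * w k"
    if "h \<in> I" "k \<in> I" "t \<in> {0..T}" for n h k t
  proof -
    have "\<bar>x (Suc n) h k t - x n h k t\<bar> \<le> 4 * C0 * w h * w k / 2 ^ n" for n
      using dominatedD[OF x_step that] by simp
    from geometric_steps_limit[OF this]
    show "(\<lambda>n. x n h k t) \<longlonglongrightarrow> c h k t" "\<bar>x n h k t - c h k t\<bar> \<le> 8 * C0 / 2 ^ n * w h * w k"
      by (simp_all add: c_def mult.assoc)
  qed
  have to_0: "(\<lambda>n. a / 2 ^ n) \<longlonglongrightarrow> 0" for a :: real
    by (rule LIMSEQ_divide_realpow_zero) simp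
  have c_bounded: "bounded_family (2 * C0) c"
    unfolding bounded_family_def dominated_def
  proof (intro conjI ballI)
    fix h k assume hk: "h \<in> I" "k \<in> I"
    have "uniform_limit {0..T} (\<lambda>n. x n h k) (c h k) sequentially"
    proof (rule uniform_limitI)
      fix e :: real assume "0 < e"
      have "\<forall>\<^sub>F n in sequentially. 8 * C0 * w h * w k / 2 ^ n < e"
        using to_0 \<open>0 < e\<close> by (rule order_tendstoD)
      then show "\<forall>\<^sub>F n in sequentially. \<forall>t\<in>{0..T}. dist (x n h k t) (c h k t) < e"
        by eventually_elim (use err[OF hk] in \<open>fastforce simp: dist_real_def intro: le_less_trans\<close>)
    qed
    then show "continuous_on {0..T} (c h k)"
      by (rule uniform_limit_theorem[rotated]) (use bounded_familyD(2)[OF x_bounded hk] in simp_all)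
    fix t assume t: "t \<in> {0..T}"
    have "\<bar>x n h k t\<bar> \<le> 2 * C0 * w h * w k" for n
      by (rule bounded_familyD(3)[OF x_bounded hk t])
    then show "\<bar>c h k t\<bar> \<le> 2 * C0 * w h * w k"
      by (intro LIMSEQ_le_const2[OF tendsto_rabs[OF lim[OF hk t]]]) blast
  qed
  have "c h k t = picard c h k t" if hkt: "h \<in> I" "k \<in> I" "t \<in> {0..T}" for h k t
  proof -
    have "\<bar>x (Suc n) h k t - picard c h k t\<bar> \<le> 8 * C0 / 2 ^ n / 2 * w h * w k" for n
      using err unfolding x_Suc
      by (intro dominatedD[OF contract[OF x_bounded c_bounded] hkt]) (auto simp: dominated_def)
    then have "norm (x (Suc n) h k t - picard c h k t) \<le> (4 * C0 * w h * w k) / 2 ^ n" for n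
      by simp
    then have "(\<lambda>n. x (Suc n) h k t - picard c h k t) \<longlonglongrightarrow> 0"
      by (intro Lim_null_comparison[OF always_eventually to_0]) blast
    then have "(\<lambda>n. x (Suc n) h k t) \<longlonglongrightarrow> picard c h k t"
      by (rule LIM_zero_cancel)
    with LIMSEQ_Suc[OF lim[OF hkt]] show ?thesis
      by (rule LIMSEQ_unique)
  qed
  note sol = picard_fixpoint_solves_system[OF c_bounded this]
  have "c h k t = c k h t" if "h \<in> I" "k \<in> I" "t \<in> {0..T}" for h k t
    using x_sym[OF that] by (simp add: c_def)
  then have "smooth_dominated_solution w T N f g c"
    unfolding smooth_dominated_solution_def using sol fixpoint_deriv_dominated[OF c_bounded sol(2)] by blast
  then show ?thesis by blast
qed

text \<open>Two solutions are fixed points of the Picard map in some common ball. The radius of that ball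
  is not under control, so the map need not contract in the norm used for existence; in the
  norm with the weight \<open>exp (\<Lambda> * (T - t))\<close> it halves distances once \<open>\<Lambda>\<close> is large.\<close>

lemma dominated_solution_unique:
  assumes c: "smooth_dominated_solution w T N f g c" and c': "smooth_dominated_solution w T N f g c'"
    and hkt: "h \<in> I" "k \<in> I" "t \<in> {0..T}"
  shows "c h k t = c' h k t"
proof -
  have bounded: "\<exists>M. bounded_family M c" if "smooth_dominated_solution w T N f g c" for c
    using that unfolding smooth_dominated_solution_def bounded_family_def
    using deriv_dominated_0_iff_dominated[OF T_pos, of c] by blast
  have mono: "bounded_family M' u" if "bounded_family M u" "M \<le> M'" for M M' u
    unfolding bounded_family_def dominated_def
  proof (intro conjI ballI)
    fix h k t assume hkt: "h \<in> I" "k \<in> I" "t \<in> {0..T}"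
    have "M * (w h * w k) \<le> M' * (w h * w k)"
      using that hkt w_nonneg by (intro mult_right_mono) auto
    then show "\<bar>u h k t\<bar> \<le> M' * w h * w k"
      using bounded_familyD(3)[OF that(1) hkt] by (simp add: mult.assoc)
  qed (rule bounded_familyD(2)[OF that(1)])
  obtain M where M: "bounded_family M c" "bounded_family M c'"
  proof -
    obtain M1 M2 where "bounded_family M1 c" "bounded_family M2 c'"
      using bounded[OF c] bounded[OF c'] by blast
    then have "bounded_family (max M1 M2) c" "bounded_family (max M1 M2) c'"
      by (auto intro: mono)
    then show ?thesis by (rule that)
  qed
  have M_nonneg: "0 \<le> M"
    using dominated_nonneg[OF bounded_familyD(1)[OF M(1)], of T] T_pos by simp
  have sol: "solves_system T N f g c" "solves_system T N f g c'"
    using c c' by (auto simp: smooth_dominated_solution_def)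
  \<comment> \<open>Integrating the weight costs a factor \<open>1 / \<Lambda>\<close>, so \<open>\<Lambda>\<close> is twice the Lipschitz constant,
    plus one to be positive.\<close>
  define \<Lambda> where "\<Lambda> = 4 * coupling_bound * M + 1"
  have \<Lambda>: "0 < \<Lambda>" using M_nonneg coupling_bound_nonneg by (simp add: \<Lambda>_def add_nonneg_pos)
  have diff: "dominated {0..T} (\<lambda>t. 2 * M / 2 ^ n * exp (\<Lambda> * (T - t))) (\<lambda>h k t. c h k t - c' h k t)" for n
  proof (induction n)
    case 0
    show ?case
      unfolding dominated_def
    proof (intro ballI)
      fix h k t assume hkt: "h \<in> I" "k \<in> I" "t \<in> {0..T}"
      have "\<bar>c h k t - c' h k t\<bar> \<le> 2 * M * w h * w k"
        using bounded_familyD(3)[OF M(1) hkt] bounded_familyD(3)[OF M(2) hkt] by simp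
      moreover have "2 * M * w h * w k * 1 \<le> 2 * M * w h * w k * exp (\<Lambda> * (T - t))"
        using M_nonneg \<Lambda> hkt w_nonneg by (intro mult_left_mono) auto
      ultimately show "\<bar>c h k t - c' h k t\<bar> \<le> 2 * M / 2 ^ 0 * exp (\<Lambda> * (T - t)) * w h * w k"
        by (simp add: mult_ac)
    qed
  next
    case (Suc n)
    show ?case
      unfolding dominated_def
    proof (intro ballI)
      fix h k t assume hkt: "h \<in> I" "k \<in> I" "t \<in> {0..T}"
      let ?\<phi> = "\<lambda>s. 2 * M / 2 ^ n * exp (\<Lambda> * (T - s))"
      have "(?\<phi> has_integral (- 2 * M / 2 ^ n / \<Lambda> * exp (\<Lambda> * (T - T)) - - 2 * M / 2 ^ n / \<Lambda> * exp (\<Lambda> * (T - t)))) {t..T}"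
        using hkt \<Lambda>
        by (intro fundamental_theorem_of_calculus)
           (auto intro!: derivative_eq_intros simp: has_real_derivative_iff_has_vector_derivative[symmetric])
      then have "integral {t..T} ?\<phi> \<le> 2 * M / 2 ^ n / \<Lambda> * exp (\<Lambda> * (T - t))"
      proof (rule ssubst[OF integral_unique])
        have "0 \<le> 2 * M / 2 ^ n / \<Lambda> * exp (\<Lambda> * (T - T))"
          using \<Lambda> M_nonneg by simp
        then show "- 2 * M / 2 ^ n / \<Lambda> * exp (\<Lambda> * (T - T)) - - 2 * M / 2 ^ n / \<Lambda> * exp (\<Lambda> * (T - t))
            \<le> 2 * M / 2 ^ n / \<Lambda> * exp (\<Lambda> * (T - t))"
          by simp
      qed
      then have "2 * coupling_bound * M * integral {t..T} ?\<phi>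
          \<le> 2 * coupling_bound * M * (2 * M / 2 ^ n / \<Lambda> * exp (\<Lambda> * (T - t)))"
        using coupling_bound_nonneg M_nonneg by (intro mult_left_mono) auto
      also have "\<dots> = (2 * coupling_bound * M / \<Lambda>) * (2 * M / 2 ^ n * exp (\<Lambda> * (T - t)))"
        by simp
      also have "\<dots> \<le> 1 / 2 * (2 * M / 2 ^ n * exp (\<Lambda> * (T - t)))"
        using M_nonneg \<Lambda> by (intro mult_right_mono) (auto simp: \<Lambda>_def divide_le_eq)
      finally have "2 * coupling_bound * M * integral {t..T} ?\<phi> * (w h * w k)
          \<le> 1 / 2 * (2 * M / 2 ^ n * exp (\<Lambda> * (T - t))) * (w h * w k)"
        using hkt w_nonneg by (intro mult_right_mono) auto
      moreover have "\<bar>c h k t - c' h k t\<bar> \<le> 2 * coupling_bound * M * integral {t..T} ?\<phi> * w h * w k"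
        using dominatedD[OF picard_lipschitz[OF M Suc] hkt]
          solution_is_picard_fixpoint[OF sol(1) M(1) hkt] solution_is_picard_fixpoint[OF sol(2) M(2) hkt]
        by (simp add: continuous_intros)
      ultimately show "\<bar>c h k t - c' h k t\<bar> \<le> 2 * M / 2 ^ Suc n * exp (\<Lambda> * (T - t)) * w h * w k"
        by (simp add: mult_ac)
    qed
  qed
  have "\<bar>c h k t - c' h k t\<bar> \<le> 2 * M * exp (\<Lambda> * (T - t)) * w h * w k / 2 ^ n" for n
    using dominatedD[OF diff hkt, of n] by simp
  moreover have "(\<lambda>n. 2 * M * exp (\<Lambda> * (T - t)) * w h * w k / 2 ^ n) \<longlonglongrightarrow> 0"
    by (rule LIMSEQ_divide_realpow_zero) simp
  ultimately have "\<bar>c h k t - c' h k t\<bar> \<le> 0"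
    by (intro LIMSEQ_le_const) auto
  then show ?thesis by simp
qed

end

section \<open>Folding a self-controlled sequence\<close>

text \<open>The two cases of the index set are treated alike by reading \<open>N = \<infinity>\<close> as the modulus \<open>0\<close>,
  for which congruence is equality.\<close>

lemma index_rep_congruence:
  obtains p :: int where "\<And>a b. index_rep N a = index_rep N b \<longleftrightarrow> p dvd a - b"
    and "\<And>a. p dvd index_rep N a - a"
proof (cases N)
  case (enat n)
  show thesis
  proof (rule that[of "int n"])
    show "index_rep N a = index_rep N b \<longleftrightarrow> int n dvd a - b" for a b
      by (simp add: enat index_rep_def mod_eq_dvd_iff)
    show "int n dvd index_rep N a - a" for a
      using index_rep_cong[of n a] by (simp add: enat mod_eq_dvd_iff)
  qed
next
  case infinity
  then show thesis
    by (intro that[of 0]) (simp_all add: index_rep_def)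
qed

lemma index_rep_id:
  assumes "h \<in> index_set N"
  shows "index_rep N h = h"
proof (cases N)
  case (enat n)
  have "0 \<le> h + int n div 2" "h + int n div 2 < int n"
    using assms by (auto simp: enat index_set_def elim!: oddE evenE split: if_splits)
  then show ?thesis
    by (simp add: enat index_rep_def)
qed (simp add: index_rep_def)

lemma index_rep_add_eq_iff:
  assumes "h \<in> index_set N"
  shows "index_rep N a = index_rep N (h - index_rep N b) \<longleftrightarrow> index_rep N (a + b) = h"
proof -
  obtain p where p: "\<And>a b. index_rep N a = index_rep N b \<longleftrightarrow> p dvd a - b"
    and rep: "\<And>a. p dvd index_rep N a - a"
    using index_rep_congruence[of N] by blast
  have "a - (h - index_rep N b) = (a + b - h) + (index_rep N b - b)" by simp
  then have "p dvd a - (h - index_rep N b) \<longleftrightarrow> p dvd a + b - h"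
    using rep[of b] by (simp only: dvd_add_left_iff)
  then show ?thesis
    unfolding p using p[of "a + b" h] index_rep_id[OF assms] by simp
qed

lemma index_rep_diff:
  "index_rep N (index_rep N a - index_rep N b) = index_rep N (a - b)"
proof -
  obtain p where p: "\<And>a b. index_rep N a = index_rep N b \<longleftrightarrow> p dvd a - b"
    and rep: "\<And>a. p dvd index_rep N a - a"
    using index_rep_congruence[of N] by blast
  have eq: "index_rep N a - index_rep N b - (a - b) = (index_rep N a - a) - (index_rep N b - b)" by simp
  show ?thesis
    unfolding p eq using rep[of a] rep[of b] by (rule dvd_diff)
qed

definition fibre :: "enat \<Rightarrow> int \<Rightarrow> int set" where
  "fibre N h = {i. index_rep N i = h}"

text \<open>The push-forward of \<open>\<beta>\<close> under reduction modulo \<open>N\<close>: reduction turns sums of indices into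
  sums modulo \<open>N\<close>, so it maps convolutions to cyclic convolutions. For \<open>N = \<infinity>\<close> this is \<open>\<beta>\<close>.\<close>

definition folded :: "(int \<Rightarrow> real) \<Rightarrow> enat \<Rightarrow> int \<Rightarrow> real" where
  "folded \<beta> N h = (\<Sum>\<^sub>\<infinity>i\<in>fibre N h. \<beta> i)"

lemma infsum_product_real:
  fixes a :: "'a \<Rightarrow> real" and b :: "'b \<Rightarrow> real"
  assumes "(\<lambda>(x, y). a x * b y) summable_on A \<times> B"
  shows "(\<Sum>\<^sub>\<infinity>(x, y)\<in>A \<times> B. a x * b y) = infsum a A * infsum b B"
proof -
  have "(\<Sum>\<^sub>\<infinity>(x, y)\<in>A \<times> B. a x * b y) = (\<Sum>\<^sub>\<infinity>x\<in>A. \<Sum>\<^sub>\<infinity>y\<in>B. a x * b y)"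
    using infsum_Sigma'_banach[OF assms] by simp
  also have "\<dots> = infsum a A * infsum b B"
    by (simp add: infsum_cmult_right' infsum_cmult_left')
  finally show ?thesis .
qed

text \<open>The cyclic convolution of the folded sequence at \<open>h\<close> is the sum of \<open>\<beta> a * \<beta> b\<close> over all pairs
  with \<open>a + b\<close> congruent to \<open>h\<close>. Grouping these pairs by the value \<open>i = a + b\<close> instead, the
  inner sums are the values of the convolution of \<open>\<beta>\<close> with itself, at most \<open>C * \<beta> i\<close>, and the
  outer sum folds the \<open>\<beta> i\<close>. So folding preserves self-control with the same constant.\<close>

lemma folded_convolution:
  fixes \<beta> :: "int \<Rightarrow> real"
  assumes \<beta>: "\<beta> summable_on UNIV" "\<And>i. 0 \<le> \<beta> i"
    and conv: "\<And>i. (\<Sum>\<^sub>\<infinity>j. \<beta> j * \<beta> (i - j)) \<le> C * \<beta> i"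
    and h: "h \<in> index_set N" and N: "1 \<le> N"
  shows "(\<lambda>j. folded \<beta> N (index_rep N (h - j)) * folded \<beta> N j) summable_on index_set N"
    and "(\<Sum>\<^sub>\<infinity>j\<in>index_set N. folded \<beta> N (index_rep N (h - j)) * folded \<beta> N j) \<le> C * folded \<beta> N h"
proof -
  let ?I = "index_set N"
  let ?s = "\<lambda>i. \<Sum>\<^sub>\<infinity>j. \<beta> j * \<beta> (i - j)"
  \<comment> \<open>The pairs \<open>(a, b)\<close> in the coordinates \<open>(a + b, b)\<close>.\<close>
  define K where "K = (\<lambda>(i, b). \<beta> b * \<beta> (i - b))"
  have le_sum: "\<beta> i \<le> infsum \<beta> UNIV" for i
    using finite_sum_le_infsum[OF \<beta>(1), of "{i}"] \<beta>(2) by simp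
  have summable: "(\<lambda>j. \<beta> j * \<beta> (i - j)) summable_on UNIV" for i
  proof (rule summable_on_comparison_test)
    show "(\<lambda>j. \<beta> j * infsum \<beta> UNIV) summable_on UNIV"
      by (intro summable_on_cmult_left \<beta>(1))
  qed (simp_all add: \<beta>(2) le_sum mult_left_mono)
  have \<beta>_fibre: "\<beta> summable_on fibre N i" for i
    using \<beta>(1) by (rule summable_on_subset_banach) simp
  have s_summable: "?s summable_on fibre N h"
  proof (rule summable_on_comparison_test)
    show "(\<lambda>i. C * \<beta> i) summable_on fibre N h"
      by (intro summable_on_cmult_right \<beta>_fibre)
  qed (simp_all add: \<beta>(2) conv infsum_nonneg)
  have K_summable: "K summable_on fibre N h \<times> UNIV"
  proof (rule summable_on_SigmaI[OF _ s_summable])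
    show "((\<lambda>b. K (i, b)) has_sum ?s i) UNIV" for i
      using has_sum_infsum[OF summable] by (simp add: K_def)
  qed (simp add: K_def \<beta>(2))
  then have "infsum K (fibre N h \<times> UNIV) = (\<Sum>\<^sub>\<infinity>i\<in>fibre N h. ?s i)"
    using infsum_Sigma_banach[OF K_summable] by (simp add: K_def)
  also have "\<dots> \<le> (\<Sum>\<^sub>\<infinity>i\<in>fibre N h. C * \<beta> i)"
    by (intro infsum_mono s_summable summable_on_cmult_right \<beta>_fibre conv)
  also have "\<dots> = C * folded \<beta> N h"
    by (simp add: folded_def infsum_cmult_right')
  finally have K_le: "infsum K (fibre N h \<times> UNIV) \<le> C * folded \<beta> N h" .

  \<comment> \<open>The same pairs grouped by the class \<open>j\<close> of \<open>b\<close>, which fixes the class of \<open>a\<close>.\<close>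
  define F where "F j = fibre N (index_rep N (h - j)) \<times> fibre N j" for j
  define L where "L = (\<lambda>j::int. \<lambda>(a, b). \<beta> a * \<beta> b)"
  have "((\<lambda>(j, z). L j z) has_sum infsum K (fibre N h \<times> UNIV)) (Sigma ?I F) \<longleftrightarrow>
      (K has_sum infsum K (fibre N h \<times> UNIV)) (fibre N h \<times> UNIV)"
    by (rule has_sum_reindex_bij_witness[where j = "\<lambda>(j, a, b). (a + b, b)"
          and i = "\<lambda>(i, b). (index_rep N b, i - b, b)"])
       (auto simp: F_def L_def K_def fibre_def index_rep_add_eq_iff[OF h] index_rep_diff index_rep_mem[OF N])
  then have L: "((\<lambda>(j, z). L j z) has_sum infsum K (fibre N h \<times> UNIV)) (Sigma ?I F)"
    using K_summable by simp
  then have L_summable: "(\<lambda>(j, z). L j z) summable_on Sigma ?I F"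
    by (rule has_sum_imp_summable)
  have prod: "infsum (L j) (F j) = folded \<beta> N (index_rep N (h - j)) * folded \<beta> N j" if "j \<in> ?I" for j
    using summable_on_SigmaD1[OF L_summable that]
    unfolding L_def F_def folded_def by (rule infsum_product_real)
  have "(\<lambda>j. infsum (L j) (F j)) summable_on ?I"
    using L_summable by (rule summable_on_Sigma_banach)
  then show "(\<lambda>j. folded \<beta> N (index_rep N (h - j)) * folded \<beta> N j) summable_on ?I"
    by (simp add: prod cong: summable_on_cong)
  have "(\<Sum>\<^sub>\<infinity>j\<in>?I. folded \<beta> N (index_rep N (h - j)) * folded \<beta> N j) = (\<Sum>\<^sub>\<infinity>j\<in>?I. infsum (L j) (F j))"
    by (simp add: prod cong: infsum_cong)
  also have "\<dots> = infsum K (fibre N h \<times> UNIV)"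
    using infsum_Sigma'_banach[OF L_summable] L by (simp add: has_sum_iff)
  finally show "(\<Sum>\<^sub>\<infinity>j\<in>?I. folded \<beta> N (index_rep N (h - j)) * folded \<beta> N j) \<le> C * folded \<beta> N h"
    using K_le by simp
qed

lemma le_folded:
  assumes "\<beta> summable_on UNIV" "\<And>i. 0 \<le> \<beta> i" "h \<in> index_set N"
  shows "\<beta> h \<le> folded \<beta> N h"
proof -
  have "\<beta> summable_on fibre N h"
    using assms(1) by (rule summable_on_subset_banach) simp
  then have "sum \<beta> {h} \<le> infsum \<beta> (fibre N h)"
    using assms(2) by (intro finite_sum_le_infsum) (auto simp: fibre_def index_rep_id[OF assms(3)])
  then show ?thesis by (simp add: folded_def)
qed

lemma folded_le_infsum:
  fixes \<beta> :: "int \<Rightarrow> real"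
  assumes "\<beta> summable_on UNIV" "\<And>i. 0 \<le> \<beta> i"
  shows "folded \<beta> N h \<le> infsum \<beta> UNIV"
  unfolding folded_def using assms
  by (intro infsum_mono2 summable_on_subset_banach[OF assms(1)]) auto

text \<open>For finite \<open>N\<close> the factor comes from the finiteness of the index set, and in general it is not bounded
  uniformly in \<open>N\<close>: if \<open>\<beta> i\<close> decays like \<open>\<bar>i\<bar> powr -4\<close> at \<open>-\<infinity>\<close> but only like \<open>\<bar>i\<bar> powr -2\<close> at
  \<open>\<infinity>\<close>, then at \<open>h = - (N div 2)\<close> it grows like \<open>N\<^sup>2\<close>. It may therefore enter the
  qualitative assertions on domination, but not the length of the time interval.\<close>

lemma folded_le_const_mult:
  fixes \<beta> :: "int \<Rightarrow> real"
  assumes \<beta>: "\<beta> summable_on UNIV" "\<And>i. 0 < \<beta> i"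
  obtains \<kappa> where "\<And>h. h \<in> index_set N \<Longrightarrow> folded \<beta> N h \<le> \<kappa> * \<beta> h"
proof (cases N)
  case (enat n)
  have "finite (index_set N)"
    by (simp add: enat index_set_def)
  have nonneg: "0 \<le> folded \<beta> N h" for h
    unfolding folded_def using \<beta>(2) by (intro infsum_nonneg less_imp_le)
  define \<kappa> where "\<kappa> = (\<Sum>h\<in>index_set N. folded \<beta> N h / \<beta> h)"
  have "folded \<beta> N h / \<beta> h \<le> \<kappa>" if "h \<in> index_set N" for h
    unfolding \<kappa>_def using that \<open>finite (index_set N)\<close>
    by (intro member_le_sum divide_nonneg_pos nonneg \<beta>(2))
  then have "folded \<beta> N h \<le> \<kappa> * \<beta> h" if "h \<in> index_set N" for h
    using pos_divide_le_eq[OF \<beta>(2)] that by blast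
  then show thesis by (rule that)
next
  case infinity
  then have "fibre N h = {h}" for h by (auto simp: fibre_def index_rep_def)
  then have "folded \<beta> N h \<le> 1 * \<beta> h" for h by (simp add: folded_def)
  then show thesis by (rule that)
qed

lemma smooth_dominated_solution_cong:
  assumes "\<And>h. h \<in> index_set N \<Longrightarrow> 0 \<le> \<beta> h \<and> \<beta> h \<le> w h \<and> w h \<le> \<kappa> * \<beta> h"
  shows "smooth_dominated_solution \<beta> T N f g c \<longleftrightarrow> smooth_dominated_solution w T N f g c"
proof -
  have "deriv_dominated \<beta> T N m u \<longleftrightarrow> deriv_dominated w T N m u" for m u
  proof
    show "deriv_dominated w T N m u" if "deriv_dominated \<beta> T N m u"
    proof (rule deriv_dominated_weaken[OF _ that])
      show "0 \<le> \<beta> h \<and> \<beta> h \<le> 1 * w h" if "h \<in> index_set N" for h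
        using assms[OF that] by simp
    qed
    show "deriv_dominated \<beta> T N m u" if "deriv_dominated w T N m u"
    proof (rule deriv_dominated_weaken[OF _ that])
      show "0 \<le> w h \<and> w h \<le> \<kappa> * \<beta> h" if "h \<in> index_set N" for h
        using assms[OF that] by linarith
    qed
  qed
  then show ?thesis
    by (simp add: smooth_dominated_solution_def)
qed

theorem theorem2p11:
  fixes \<beta> :: "int \<Rightarrow> real" and C0 :: real
  assumes "(\<lambda>i. \<bar>\<beta> i\<bar>) summable_on UNIV"
    and "\<forall>i. 0 < \<beta> i"
    and "c_self_controlled \<beta>"
    and "0 < C0"
  shows "\<exists>Tstar>0. \<forall>T. 0 < T \<and> T \<le> Tstar \<longrightarrow>
    (\<forall>(N::enat) (f :: int \<Rightarrow> int \<Rightarrow> real \<Rightarrow> real) (g :: int \<Rightarrow> int \<Rightarrow> real).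
       1 \<le> N \<and> admissible_data \<beta> C0 T N f g \<longrightarrow>
       (\<exists>c. smooth_dominated_solution \<beta> T N f g c \<and>
            (\<forall>c'. smooth_dominated_solution \<beta> T N f g c' \<longrightarrow>
               (\<forall>h\<in>index_set N. \<forall>k\<in>index_set N. \<forall>t\<in>{0..T}. c' h k t = c h k t))))"
proof -
  have pos: "0 < \<beta> i" and nonneg: "0 \<le> \<beta> i" for i
    using assms(2) by (auto simp: less_imp_le)
  have summable: "\<beta> summable_on UNIV"
    using assms(1) nonneg by simp
  obtain C where C: "0 < C" and conv: "\<And>i. (\<Sum>\<^sub>\<infinity>j. \<beta> j * \<beta> (i - j)) \<le> C * \<beta> i"
    using assms(3) unfolding c_self_controlled_def by blast
  define A where "A = infsum \<beta> UNIV"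
  have A: "0 \<le> A" unfolding A_def by (intro infsum_nonneg nonneg)
  \<comment> \<open>\<open>B\<close> bounds \<open>coupling_bound\<close> for every folded weight, since \<open>folded \<beta> N 0 \<le> A\<close>.\<close>
  define B where "B = A\<^sup>2 + 2 * C * A"
  have B: "0 \<le> B" using A C by (simp add: B_def)
  define Tstar where "Tstar = 1 / (8 * B * C0 + 1)"
  have denom: "0 < 8 * B * C0 + 1"
    using B assms(4) by (simp add: add_nonneg_pos)
  have main: "\<exists>c. smooth_dominated_solution \<beta> T N f g c \<and>
            (\<forall>c'. smooth_dominated_solution \<beta> T N f g c' \<longrightarrow>
               (\<forall>h\<in>index_set N. \<forall>k\<in>index_set N. \<forall>t\<in>{0..T}. c' h k t = c h k t))"
    if T: "0 < T" "T \<le> Tstar" and N: "1 \<le> N" and data: "admissible_data \<beta> C0 T N f g"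
    for T N and f :: "int \<Rightarrow> int \<Rightarrow> real \<Rightarrow> real" and g :: "int \<Rightarrow> int \<Rightarrow> real"
  proof -
    let ?w = "folded \<beta> N"
    note le_w = le_folded[OF summable nonneg]
    interpret convolution_weight N ?w C
    proof
      show "0 < ?w h" if "h \<in> index_set N" for h
        using pos le_w[OF that] by (rule less_le_trans)
    qed (use N C folded_convolution[OF summable nonneg conv] in auto)
    have "admissible_data ?w C0 T N f g"
    proof -
      have "C0 * \<beta> h * \<beta> k \<le> C0 * ?w h * ?w k" if "h \<in> I" "k \<in> I" for h k
        using le_w[OF that(1)] le_w[OF that(2)] nonneg assms(4) w_nonneg[OF that(1)]
        by (intro mult_mono mult_left_mono) auto
      then show ?thesis
        using data order_trans[of _ "C0 * \<beta> _ * \<beta> _" "C0 * ?w _ * ?w _"]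
        unfolding admissible_data_def by blast
    qed
    then interpret backward_problem N ?w C T C0 f g
      using T by unfold_locales
    have "?w 0 \<le> A" unfolding A_def using summable nonneg by (rule folded_le_infsum)
    then have "coupling_bound \<le> B"
      unfolding coupling_bound_def B_def
      using w_nonneg[OF zero_mem] C by (intro add_mono power_mono mult_left_mono) auto
    then have "T * (8 * coupling_bound * C0 + 1) \<le> T * (8 * B * C0 + 1)"
      using T assms(4) by (intro mult_left_mono add_right_mono mult_right_mono) auto
    also have "\<dots> \<le> 1"
      using T denom by (simp add: Tstar_def pos_le_divide_eq)
    finally obtain c where c: "smooth_dominated_solution ?w T N f g c"
      using short_time_existence by blast
    obtain \<kappa> where "\<And>h. h \<in> index_set N \<Longrightarrow> ?w h \<le> \<kappa> * \<beta> h"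
      using folded_le_const_mult[OF summable pos] by blast
    then have "smooth_dominated_solution \<beta> T N f g c \<longleftrightarrow> smooth_dominated_solution ?w T N f g c" for c
      using nonneg le_w by (intro smooth_dominated_solution_cong) auto
    then show ?thesis
      using c dominated_solution_unique[OF _ c] by blast
  qed
  have "0 < Tstar" using denom by (simp add: Tstar_def)
  with main show ?thesis by blast
qed

end
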